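(* Let $((X^n(t))_{t\in[0,T]})_{n\in\mathbb{N}}$ be a family of $p$-dimensional, continuous, centered Gaussian processes, starting from zero, with independent components, which satisfies an LDP on $C([0,T],\mathbb{R}^p)$ with speed $\gamma_n$ and good rate function $$I(h)=\sum_{i=1}^p I_i(h_i),\qquad I_i(h_i)=\begin{cases}\frac12\|h_i\|^2_{\mathscr{H}_i} & h_i\in\mathscr{H}_i\\ +\infty & h_i\notin\mathscr{H}_i,\end{cases}$$ where $\mathscr{H}_i\subset C([0,T],\mathbb{R})$ is the reproducing kernel Hilbert space associated to some covariance function $k_{ii}$. Let $((A^n,B^n))_{n\in\mathbb{N}}$ be a $[0,+\infty)\times C([0,T],\mathbb{R}^p)$-valued random sequence, independent of $(X^n)_{n\in\mathbb{N}}$, and set $Z^n(t)=A^nX^n(t)+B^n(t)$ for $t\in[0,T]$, $n\in\mathbb{N}$. Assume that: - $(A^n)_{n\in\mathbb{N}}$ is a family of positive random variables satisfying the LDP on $[0,+\infty)$ with speed $\gamma_n$ and good rate function $x\mapsto dx^\theta$ ($x\ge0$), for some $d,\theta>0$; - $(B^n)_{n\in\mathbb{N}}$ satisfies an LDP with speed $\gamma_n$ and good rate function $I_B$; - $(A^n)_{n\in\mathbb{N}}$ and $(B^n)_{n\in\mathbb{N}}$ are independent. Then $((A^n,B^n),Z^n)_{n\in\mathbb{N}}$ satisfies an LDP with speed $\gamma_n$ and rate function $$I_{(A,B),Z}((a,b),z)=I_B(b)+da^\theta+\sum_{i=1}^pJ_i(z_i|(a,b_i)),\qquad J_i(z_i|(a,b_i))=\begin{cases}\frac{1}{2a^2}\|z_i-b_i\|^2_{\mathscr{H}_i}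 & a>0\\ 0 & z_i-b_i=0\text{ and }a=0\\ +\infty&\text{otherwise;}\end{cases}$$ so in particular $$I_{(A,B),Z}((a,b),z)=\begin{cases}I_B(b)+da^\theta+\sum_{i=1}^p\frac1{2a^2}\|z_i-b_i\|^2_{\mathscr{H}_i}&\text{if }a>0\\ I_B(b)&\text{if }a=0\text{ and }z_i-b_i=0,\ i=1,\ldots,p\\ +\infty&\text{otherwise.}\end{cases}$$ Moreover $(Z^n)_{n\in\mathbb{N}}$ satisfies an LDP with speed $\gamma_n$ and the good rate function $$I_Z(z)=\inf_{(a,b)\in[0,+\infty)\times C([0,T],\mathbb{R}^p)}\Big\{I_B(b)+da^\theta+\sum_{i=1}^pJ_i(z_i|(a,b_i))\Big\}$$ $$=\inf_{b\in C([0,T],\mathbb{R}^p)}\Big\{I_B(b)+\psi(d,\theta)\Big(\frac12\sum_{i=1}^p\|z_i-b_i\|^2_{\mathscr{H}_i}\Big)^{\theta/(\theta+2)}\Big\}.$$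
   Context: $T>0$ and $p\ge1$ are fixed. $C([0,T],\mathbb{R}^p)$ carries the sup-norm; product spaces carry the product topology. For $d,\theta>0$, $$\psi(d,\theta):=2^{\theta/(\theta+2)}\Big(d(d\theta)^{-\theta/(\theta+2)}+\frac12(d\theta)^{2/(\theta+2)}\Big).$$ Large deviation principle (LDP): let $E$ be a topological space with Borel $\sigma$-algebra and $\gamma_n>0$ with $\gamma_n\to+\infty$ (the speed). A rate function is a lower semicontinuous $I:E\to[0,+\infty]$; it is good if $\{I\le a\}$ is compact for all $a\ge0$. Probability measures $(\mu_n)$ satisfy the LDP on $E$ with rate function $I$ and speed $\gamma_n$ if $\liminf_n\frac1{\gamma_n}\log\mu_n(\Theta)\ge-\inf_{x\in\Theta}I(x)$ for every open $\Theta$ and $\limsup_n\frac1{\gamma_n}\log\mu_n(\Gamma)\le-\inf_{x\in\Gamma}I(x)$ for every closed $\Gamma$. Random elements satisfy an LDP if their laws do. Reproducing kernel Hilbert space (RKHS): let $U=(U(t))_{t\in[0,T]}$ be a real continuous centered Gaussian process with covariance function $k$. Let $H$ be the $L^2$-closure of $\{\int_0^TU(t)\,d\lambda(t):\lambda\text{ a signed measure on }[0,T]\}$. The RKHS of $k$ is $\mathscr{H}=\{h: h(t)=\mathbb{E}[U(t)Y],\ Y\in H\}\subset C([0,T],\mathbb{R})$, with inner product transported from $L^2$ by the bijection $Y\mapsto\mathbb{E}[U(\cdot)Y]$. Equivalently it is the completion of the functions $x(t)=\int_0^Tk(t,s)\,d\lambda(s)$ under $\|x\|^2=\int_0^T\int_0^Tk(t,s)\,d\lambda(t)\,d\lambda(s)$.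 Conventions: $\|h\|^2_{\mathscr{H}_i}=+\infty$ if $h\notin\mathscr{H}_i$; a positive power of $+\infty$ is $+\infty$. *)

theory Defs
  imports "HOL-Probability.Probability"
begin

section \<open>Path space\<close>

text \<open>
  \<open>C([0,T], E)\<close> with the sup-metric.  As for every \<^const>\<open>cfunspace\<close>, its points are functions on
  \<open>\<real>\<close> that are continuous on \<open>[0,T]\<close> and equal to \<^const>\<open>undefined\<close> outside \<open>[0,T]\<close>; every path built
  below is therefore wrapped in a restriction \<open>\<lambda>t\<in>{0..T}. _\<close>.
\<close>

definition path_metric :: "real \<Rightarrow> (real \<Rightarrow> 'a::metric_space) metric" where
  "path_metric T = cfunspace (top_of_set {0..T}) euclidean_metric"

definition path_space :: "real \<Rightarrow> (real \<Rightarrow> 'a::metric_space) set" where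
  "path_space T = mspace (path_metric T)"

definition path_top :: "real \<Rightarrow> (real \<Rightarrow> 'a::metric_space) topology" where
  "path_top T = mtopology_of (path_metric T)"

definition path_coord :: "real \<Rightarrow> 'p \<Rightarrow> (real \<Rightarrow> real ^ 'p::finite) \<Rightarrow> real \<Rightarrow> real" where
  "path_coord T i z = (\<lambda>t\<in>{0..T}. z t $ i)"

definition path_diff :: "real \<Rightarrow> (real \<Rightarrow> 'a::real_normed_vector) \<Rightarrow> (real \<Rightarrow> 'a) \<Rightarrow> real \<Rightarrow> 'a" where
  "path_diff T z b = (\<lambda>t\<in>{0..T}. z t - b t)"

definition path_affine ::
  "real \<Rightarrow> real \<Rightarrow> (real \<Rightarrow> 'a::real_normed_vector) \<Rightarrow> (real \<Rightarrow> 'a) \<Rightarrow> real \<Rightarrow> 'a" where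
  "path_affine T a x b = (\<lambda>t\<in>{0..T}. a *\<^sub>R x t + b t)"

abbreviation half_line :: "real topology" where
  "half_line \<equiv> top_of_set {0..}"


section \<open>Large deviation principles\<close>

definition borel_of :: "'a topology \<Rightarrow> 'a measure" where
  "borel_of E = sigma (topspace E) {U. openin E U}"

definition rate_function :: "'a topology \<Rightarrow> ('a \<Rightarrow> ennreal) \<Rightarrow> bool" where
  "rate_function E I \<longleftrightarrow> (\<forall>a. closedin E {x \<in> topspace E. I x \<le> a})"

definition good_rate_function :: "'a topology \<Rightarrow> ('a \<Rightarrow> ennreal) \<Rightarrow> bool" where
  "good_rate_function E I \<longleftrightarrow> rate_function E I \<and>
     (\<forall>a\<ge>0. compactin E {x \<in> topspace E. I x \<le> ennreal a})"

text \<open>The library's real logarithm has \<open>ln 0 = 0\<close>, whereas here \<open>log 0 = -\<infinity>\<close>.\<close>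

definition log_prob :: "real \<Rightarrow> ereal" where
  "log_prob q = (if q = 0 then -\<infinity> else ereal (ln q))"

definition LDP :: "'a topology \<Rightarrow> (nat \<Rightarrow> 'a measure) \<Rightarrow> (nat \<Rightarrow> real) \<Rightarrow> ('a \<Rightarrow> ennreal) \<Rightarrow> bool" where
  "LDP E \<mu> \<gamma> I \<longleftrightarrow>
     (\<forall>n. prob_space (\<mu> n) \<and> sets (\<mu> n) = sets (borel_of E)) \<and>
     rate_function E I \<and>
     (\<forall>\<Theta>. openin E \<Theta> \<longrightarrow>
        - enn2ereal (INF x\<in>\<Theta>. I x)
          \<le> liminf (\<lambda>n. ereal (1 / \<gamma> n) * log_prob (measure (\<mu> n) \<Theta>))) \<and>
     (\<forall>\<Gamma>. closedin E \<Gamma> \<longrightarrow>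
        limsup (\<lambda>n. ereal (1 / \<gamma> n) * log_prob (measure (\<mu> n) \<Gamma>))
          \<le> - enn2ereal (INF x\<in>\<Gamma>. I x))"

definition satisfies_LDP ::
  "'w measure \<Rightarrow> 'a topology \<Rightarrow> (nat \<Rightarrow> 'w \<Rightarrow> 'a) \<Rightarrow> (nat \<Rightarrow> real) \<Rightarrow> ('a \<Rightarrow> ennreal) \<Rightarrow> bool" where
  "satisfies_LDP M E Y \<gamma> I \<longleftrightarrow>
     (\<forall>n. Y n \<in> M \<rightarrow>\<^sub>M borel_of E) \<and> LDP E (\<lambda>n. distr M (borel_of E) (Y n)) \<gamma> I"


section \<open>Independence and Gaussian processes\<close>

text \<open>
  \<^const>\<open>prob_space.indep_var\<close> requires both random elements to have the same type; this is the
  characterisation given by its lemma \<open>indep_var_eq\<close> without that restriction.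
\<close>

definition indep_elements ::
  "'w measure \<Rightarrow> 'a measure \<Rightarrow> ('w \<Rightarrow> 'a) \<Rightarrow> 'b measure \<Rightarrow> ('w \<Rightarrow> 'b) \<Rightarrow> bool" where
  "indep_elements M S Y S' Y' \<longleftrightarrow>
     Y \<in> M \<rightarrow>\<^sub>M S \<and> Y' \<in> M \<rightarrow>\<^sub>M S' \<and>
     prob_space.indep_set M
       (sigma_sets (space M) {Y -` D \<inter> space M | D. D \<in> sets S})
       (sigma_sets (space M) {Y' -` D \<inter> space M | D. D \<in> sets S'})"

text \<open>Degenerate laws (zero variance) count as Gaussian.\<close>

definition centered_gaussian :: "'w measure \<Rightarrow> ('w \<Rightarrow> real) \<Rightarrow> bool" where
  "centered_gaussian M Y \<longleftrightarrow> Y \<in> borel_measurable M \<and>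
     (distr M borel Y = return borel 0 \<or>
      (\<exists>\<sigma>>0. distr M borel Y = density lborel (\<lambda>x. ennreal (normal_density 0 \<sigma> x))))"

text \<open>
  A continuous process is a random element of the path space, \<open>X \<omega> t\<close> being its value at time \<open>t\<close>;
  it is centered Gaussian if all linear combinations of its (coordinates of) values are.
\<close>

definition continuous_centered_gaussian_process ::
  "real \<Rightarrow> 'w measure \<Rightarrow> ('w \<Rightarrow> real \<Rightarrow> 'a::euclidean_space) \<Rightarrow> bool" where
  "continuous_centered_gaussian_process T M X \<longleftrightarrow>
     prob_space M \<and> X \<in> M \<rightarrow>\<^sub>M borel_of (path_top T) \<and>
     (\<forall>J c. finite J \<longrightarrow> J \<subseteq> {0..T} \<longrightarrow> centered_gaussian M (\<lambda>\<omega>. \<Sum>t\<in>J. c t \<bullet> X \<omega> t))"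

definition has_covariance ::
  "real \<Rightarrow> 'w measure \<Rightarrow> ('w \<Rightarrow> real \<Rightarrow> real) \<Rightarrow> (real \<Rightarrow> real \<Rightarrow> real) \<Rightarrow> bool" where
  "has_covariance T M U k \<longleftrightarrow> (\<forall>s\<in>{0..T}. \<forall>t\<in>{0..T}. k s t = (\<integral>\<omega>. U \<omega> s * U \<omega> t \<partial>M))"


section \<open>Reproducing kernel Hilbert spaces\<close>

text \<open>
  A signed measure on \<open>[0,T]\<close> is given as a difference \<open>\<nu>\<^sub>1 - \<nu>\<^sub>2\<close> of two finite Borel measures, and
  its integral as the difference of the two integrals (Jordan decomposition).
\<close>

definition path_integrals :: "real \<Rightarrow> 'u measure \<Rightarrow> ('u \<Rightarrow> real \<Rightarrow> real) \<Rightarrow> ('u \<Rightarrow> real) set" where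
  "path_integrals T N U =
     {(\<lambda>\<omega>. (\<integral>t. U \<omega> t \<partial>\<nu>\<^sub>1) - (\<integral>t. U \<omega> t \<partial>\<nu>\<^sub>2)) | \<nu>\<^sub>1 \<nu>\<^sub>2.
        finite_measure \<nu>\<^sub>1 \<and> sets \<nu>\<^sub>1 = sets (restrict_space borel {0..T}) \<and>
        finite_measure \<nu>\<^sub>2 \<and> sets \<nu>\<^sub>2 = sets (restrict_space borel {0..T})}"

text \<open>The \<open>L\<^sup>2\<close>-closure, as a set of functions rather than of almost-everywhere classes.\<close>

definition gaussian_space :: "real \<Rightarrow> 'u measure \<Rightarrow> ('u \<Rightarrow> real \<Rightarrow> real) \<Rightarrow> ('u \<Rightarrow> real) set" where
  "gaussian_space T N U =
     {Y \<in> borel_measurable N. integrable N (\<lambda>\<omega>. (Y \<omega>)\<^sup>2) \<and>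
        (\<forall>\<epsilon>>0. \<exists>V\<in>path_integrals T N U. (\<integral>\<^sup>+\<omega>. ennreal ((Y \<omega> - V \<omega>)\<^sup>2) \<partial>N) < ennreal \<epsilon>)}"

definition rkhs_map :: "real \<Rightarrow> 'u measure \<Rightarrow> ('u \<Rightarrow> real \<Rightarrow> real) \<Rightarrow> ('u \<Rightarrow> real) \<Rightarrow> real \<Rightarrow> real" where
  "rkhs_map T N U Y = (\<lambda>t\<in>{0..T}. \<integral>\<omega>. U \<omega> t * Y \<omega> \<partial>N)"

definition rkhs :: "real \<Rightarrow> 'u measure \<Rightarrow> ('u \<Rightarrow> real \<Rightarrow> real) \<Rightarrow> (real \<Rightarrow> real) set" where
  "rkhs T N U = rkhs_map T N U ` gaussian_space T N U"

text \<open>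
  The squared norm transported from \<open>L\<^sup>2\<close>, extended by \<open>\<infinity>\<close> outside the space.  On the Gaussian space
  \<^const>\<open>rkhs_map\<close> is injective up to almost-everywhere equality, so the preimage picked by
  \<^const>\<open>inv_into\<close> is irrelevant.
\<close>

definition rkhs_sqnorm :: "real \<Rightarrow> 'u measure \<Rightarrow> ('u \<Rightarrow> real \<Rightarrow> real) \<Rightarrow> (real \<Rightarrow> real) \<Rightarrow> ennreal" where
  "rkhs_sqnorm T N U h =
     (if h \<in> rkhs T N U
      then ennreal (\<integral>\<omega>. (inv_into (gaussian_space T N U) (rkhs_map T N U) h \<omega>)\<^sup>2 \<partial>N)
      else \<infinity>)"


section \<open>Rate functions\<close>

definition psi :: "real \<Rightarrow> real \<Rightarrow> real" where
  "psi d \<theta> = 2 powr (\<theta> / (\<theta> + 2)) *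
     (d * (d * \<theta>) powr (- \<theta> / (\<theta> + 2)) + 1 / 2 * (d * \<theta>) powr (2 / (\<theta> + 2)))"

text \<open>Only used with exponents \<open>r > 0\<close>.\<close>

definition ennreal_powr :: "ennreal \<Rightarrow> real \<Rightarrow> ennreal" where
  "ennreal_powr x r = (if x = \<infinity> then \<infinity> else ennreal (enn2real x powr r))"

definition rate_J :: "real \<Rightarrow> 'u measure \<Rightarrow> ('u \<Rightarrow> real \<Rightarrow> real) \<Rightarrow>
    (real \<Rightarrow> real) \<Rightarrow> real \<times> (real \<Rightarrow> real) \<Rightarrow> ennreal" where
  "rate_J T N U z = (\<lambda>(a, b).
     if a > 0 then ennreal (1 / (2 * a\<^sup>2)) * rkhs_sqnorm T N U (path_diff T z b)
     else if path_diff T z b = (\<lambda>t\<in>{0..T}. 0) \<and> a = 0 then 0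
     else \<infinity>)"

definition rate_ABZ :: "real \<Rightarrow> ('p::finite \<Rightarrow> 'u measure) \<Rightarrow> ('p \<Rightarrow> 'u \<Rightarrow> real \<Rightarrow> real) \<Rightarrow>
    real \<Rightarrow> real \<Rightarrow> ((real \<Rightarrow> real ^ 'p) \<Rightarrow> ennreal) \<Rightarrow>
    (real \<times> (real \<Rightarrow> real ^ 'p)) \<times> (real \<Rightarrow> real ^ 'p) \<Rightarrow> ennreal" where
  "rate_ABZ T N U d \<theta> I_B = (\<lambda>((a, b), z).
     I_B b + ennreal (d * a powr \<theta>) +
     (\<Sum>i\<in>UNIV. rate_J T (N i) (U i) (path_coord T i z) (a, path_coord T i b)))"

definition rate_Z :: "real \<Rightarrow> ('p::finite \<Rightarrow> 'u measure) \<Rightarrow> ('p \<Rightarrow> 'u \<Rightarrow> real \<Rightarrow> real) \<Rightarrow>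
    real \<Rightarrow> real \<Rightarrow> ((real \<Rightarrow> real ^ 'p) \<Rightarrow> ennreal) \<Rightarrow> (real \<Rightarrow> real ^ 'p) \<Rightarrow> ennreal" where
  "rate_Z T N U d \<theta> I_B z = (INF ab\<in>{0..} \<times> path_space T. rate_ABZ T N U d \<theta> I_B (ab, z))"

end

theory Submission
  imports Defs
begin

text \<open>
  The process \<open>Z = A X + B\<close> is a continuous image of the triple \<open>((A, B), X)\<close>, whose components are
  independent.  So the large deviation principles (LDPs) of \<open>((A, B), Z)\<close> and of \<open>Z\<close> come from three
  general facts and two computations.

  Independence: if two independent sequences satisfy LDPs with good rate functions on regular,
  second countable spaces, the pair satisfies the LDP whose rate function is the sum
  (\<open>satisfies_LDP_independent_pair\<close>).  The upper bound is direct: a pair can only reach a closed set at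
  cost below \<open>b\<close> near the compact product of the two level sets at height \<open>b\<close>, which finitely many small
  boxes cover, and on each box independence adds up the two costs.  Applied twice, this gives the LDP of
  \<open>((A, B), X)\<close> with rate \<open>d a\<^sup>\<theta> + I\<^sub>B(b) + I(x)\<close>; the Borel sets of the product spaces are
  generated by rectangles because \<open>C([0,T])\<close> is separable (\<open>second_countable_path_top\<close>).

  Contraction: \<open>((a, b), x) \<mapsto> ((a, b), a x + b)\<close> and then the projection to the last component are
  continuous, so both LDPs follow from the contraction principle (\<open>contraction_principle\<close>), the rate of
  a point being the infimum of the rates of its preimages.

  First computation (\<open>rate_ABZ_eq_INF\<close>): for \<open>a > 0\<close> the only preimage of \<open>((a, b), z)\<close> is
  \<open>x = (z - b) / a\<close>, and \<open>I(x)\<close> is \<open>1 / (2 a\<^sup>2)\<close> times the squared norm of \<open>z - b\<close>; for \<open>a = 0\<close> there is a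
  preimage only if \<open>z = b\<close>, and then \<open>x = 0\<close> costs nothing.  This needs the squared norm of the
  reproducing kernel Hilbert space to be homogeneous and to vanish exactly at \<open>0\<close>, hence to be independent
  of the element of the Gaussian space that represents a path.  That in turn is injectivity of
  \<open>Y \<mapsto> E[U(\<cdot>) Y]\<close> on the Gaussian space (\<open>rkhs_map_inj_AE\<close>): by Fubini's theorem a variable that is
  orthogonal to every \<open>U(t)\<close> is orthogonal to all integrals of \<open>U\<close> against measures.

  Second computation (\<open>INF_scaling_cost\<close>): minimising \<open>d a\<^sup>\<theta> + S / a\<^sup>2\<close> over the scale \<open>a\<close> gives
  \<open>\<psi>(d, \<theta>)\<close> times the \<open>\<theta> / (\<theta> + 2)\<close>-th power of \<open>S\<close>.
\<close>

section \<open>Borel sets of a topology\<close>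

lemma space_borel_of [simp]: "space (borel_of E) = topspace E"
  by (auto simp: borel_of_def space_measure_of_conv)

lemma sets_borel_of: "sets (borel_of E) = sigma_sets (topspace E) {U. openin E U}"
  unfolding borel_of_def by (rule sets_measure_of) (auto dest: openin_subset)

lemma open_in_sets_borel_of: "openin E U \<Longrightarrow> U \<in> sets (borel_of E)"
  by (simp add: sets_borel_of)

lemma closed_in_sets_borel_of:
  assumes "closedin E C" shows "C \<in> sets (borel_of E)"
proof -
  have "space (borel_of E) - (topspace E - C) \<in> sets (borel_of E)"
    using assms by (intro sets.compl_sets open_in_sets_borel_of) auto
  moreover have "space (borel_of E) - (topspace E - C) = C"
    using closedin_subset[OF assms] by auto
  ultimately show ?thesis by simp
qed

lemma measurable_borel_of:
  assumes "\<And>\<omega>. \<omega> \<in> space M \<Longrightarrow> Y \<omega> \<in> topspace E"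
    and "\<And>U. openin E U \<Longrightarrow> Y -` U \<inter> space M \<in> sets M"
  shows "Y \<in> M \<rightarrow>\<^sub>M borel_of E"
  unfolding borel_of_def
  by (rule measurable_measure_of) (use assms in \<open>auto dest: openin_subset\<close>)

lemma continuous_map_measurable_borel_of:
  assumes "continuous_map E F f"
  shows "f \<in> borel_of E \<rightarrow>\<^sub>M borel_of F"
proof (rule measurable_borel_of)
  fix U assume "openin F U"
  then have "openin E {x \<in> topspace E. f x \<in> U}"
    using assms by (rule openin_continuous_map_preimage[rotated])
  then show "f -` U \<inter> space (borel_of E) \<in> sets (borel_of E)"
    by (simp add: open_in_sets_borel_of vimage_def Int_def conj_commute)
qed (use continuous_map_funspace[OF assms] in auto)

text \<open>
  These rectangles make a pair of Borel random elements a Borel random element of the product: without a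
  countable base, the product topology may have open sets outside the product \<open>\<sigma>\<close>-algebra.
\<close>

lemma second_countable_prod_rectangles:
  assumes "second_countable E1" "second_countable E2"
  obtains R where "countable R" "\<And>U V. (U, V) \<in> R \<Longrightarrow> openin E1 U \<and> openin E2 V"
    "\<And>W p. openin (prod_topology E1 E2) W \<Longrightarrow> p \<in> W \<Longrightarrow> \<exists>(U, V)\<in>R. p \<in> U \<times> V \<and> U \<times> V \<subseteq> W"
proof -
  obtain B1 where B1: "countable B1" "\<And>V. V \<in> B1 \<Longrightarrow> openin E1 V"
      "\<And>U x. openin E1 U \<Longrightarrow> x \<in> U \<Longrightarrow> \<exists>V\<in>B1. x \<in> V \<and> V \<subseteq> U"
    using assms(1) unfolding second_countable_def by metis
  obtain B2 where B2: "countable B2" "\<And>V. V \<in> B2 \<Longrightarrow> openin E2 V"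
      "\<And>U x. openin E2 U \<Longrightarrow> x \<in> U \<Longrightarrow> \<exists>V\<in>B2. x \<in> V \<and> V \<subseteq> U"
    using assms(2) unfolding second_countable_def by metis
  show ?thesis
  proof (rule that[of "B1 \<times> B2"])
    show "countable (B1 \<times> B2)" using B1(1) B2(1) by blast
    show "openin E1 U \<and> openin E2 V" if "(U, V) \<in> B1 \<times> B2" for U V
      using that B1(2) B2(2) by blast
    fix W p assume W: "openin (prod_topology E1 E2) W" and p: "p \<in> W"
    obtain U V where UV: "openin E1 U" "openin E2 V" "fst p \<in> U" "snd p \<in> V" "U \<times> V \<subseteq> W"
      using W p unfolding openin_prod_topology_alt by (metis prod.collapse)
    obtain U' where U': "U' \<in> B1" "fst p \<in> U'" "U' \<subseteq> U" using B1(3)[OF UV(1,3)] by auto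
    obtain V' where V': "V' \<in> B2" "snd p \<in> V'" "V' \<subseteq> V" using B2(3)[OF UV(2,4)] by auto
    have "U' \<times> V' \<subseteq> W" using U'(3) V'(3) UV(5) by blast
    with U' V' show "\<exists>(U, V)\<in>B1 \<times> B2. p \<in> U \<times> V \<and> U \<times> V \<subseteq> W"
      by (intro bexI[of _ "(U', V')"]) (auto simp: mem_Times_iff)
  qed
qed

lemma second_countable_prod_topology:
  assumes "second_countable E1" "second_countable E2"
  shows "second_countable (prod_topology E1 E2)"
proof -
  obtain R where R: "countable R" "\<And>U V. (U, V) \<in> R \<Longrightarrow> openin E1 U \<and> openin E2 V"
    "\<And>W p. openin (prod_topology E1 E2) W \<Longrightarrow> p \<in> W \<Longrightarrow> \<exists>(U, V)\<in>R. p \<in> U \<times> V \<and> U \<times> V \<subseteq> W"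
    by (rule second_countable_prod_rectangles[OF assms]) blast
  show ?thesis
    unfolding second_countable_def
  proof (intro exI[of _ "(\<lambda>(U, V). U \<times> V) ` R"] conjI ballI allI impI)
    show "countable ((\<lambda>(U, V). U \<times> V) ` R)" using R(1) by simp
    show "openin (prod_topology E1 E2) V" if "V \<in> (\<lambda>(U, V). U \<times> V) ` R" for V
      using that R(2) by (auto simp: openin_prod_Times_iff)
    show "\<exists>V\<in>(\<lambda>(U, V). U \<times> V) ` R. p \<in> V \<and> V \<subseteq> W"
      if "openin (prod_topology E1 E2) W \<and> p \<in> W" for W p
      using R(3)[of W p] that by auto
  qed
qed

lemma measurable_pair_borel_of:
  assumes sc: "second_countable E1" "second_countable E2"
    and Y: "Y1 \<in> M \<rightarrow>\<^sub>M borel_of E1" "Y2 \<in> M \<rightarrow>\<^sub>M borel_of E2"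
  shows "(\<lambda>\<omega>. (Y1 \<omega>, Y2 \<omega>)) \<in> M \<rightarrow>\<^sub>M borel_of (prod_topology E1 E2)"
proof (rule measurable_borel_of)
  fix \<omega> assume "\<omega> \<in> space M"
  then show "(Y1 \<omega>, Y2 \<omega>) \<in> topspace (prod_topology E1 E2)"
    using measurable_space[OF Y(1)] measurable_space[OF Y(2)] by simp
next
  fix W assume W: "openin (prod_topology E1 E2) W"
  obtain R where R: "countable R" "\<And>U V. (U, V) \<in> R \<Longrightarrow> openin E1 U \<and> openin E2 V"
    "\<And>W p. openin (prod_topology E1 E2) W \<Longrightarrow> p \<in> W \<Longrightarrow> \<exists>(U, V)\<in>R. p \<in> U \<times> V \<and> U \<times> V \<subseteq> W"
    by (rule second_countable_prod_rectangles[OF sc]) blast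
  define R' where "R' = {r \<in> R. fst r \<times> snd r \<subseteq> W}"
  have "countable R'" unfolding R'_def using R(1) by simp
  have "\<exists>r\<in>R'. x \<in> fst r \<and> y \<in> snd r" if "(x, y) \<in> W" for x y
    using R(3)[OF W that] by (fastforce simp: R'_def)
  then have "(\<lambda>\<omega>. (Y1 \<omega>, Y2 \<omega>)) -` W \<inter> space M =
      (\<Union>r\<in>R'. (Y1 -` fst r \<inter> space M) \<inter> (Y2 -` snd r \<inter> space M))"
    by (fastforce simp: R'_def)
  also have "\<dots> \<in> sets M"
    using R(2) \<open>countable R'\<close>
    by (intro sets.countable_UN')
       (auto simp: R'_def intro!: sets.Int measurable_sets[OF Y(1)] measurable_sets[OF Y(2)]
          open_in_sets_borel_of)
  finally show "(\<lambda>\<omega>. (Y1 \<omega>, Y2 \<omega>)) -` W \<inter> space M \<in> sets M" .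
qed

lemma second_countable_euclidean:
  "second_countable (euclidean :: 'a::second_countable_topology topology)"
proof -
  obtain B :: "'a set set" where B: "countable B" "\<And>C. C \<in> B \<Longrightarrow> open C"
      "\<And>S. open S \<Longrightarrow> \<exists>U. U \<subseteq> B \<and> S = \<Union>U"
    using univ_second_countable by blast
  have "\<exists>V\<in>B. x \<in> V \<and> V \<subseteq> S" if "open S" "x \<in> S" for S x
    using B(3)[OF that(1)] that(2) by blast
  then show ?thesis
    unfolding second_countable_def using B(1,2) by (intro exI[of _ B]) auto
qed

section \<open>Exponential form of the large deviation bounds\<close>

lemma scaled_log_prob_le_iff:
  assumes "g > 0" "0 \<le> q"
  shows "ereal (1 / g) * log_prob q \<le> ereal (- \<beta>) \<longleftrightarrow> q \<le> exp (- \<beta> * g)"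
proof (cases "q = 0")
  case True
  then show ?thesis using assms by (simp add: log_prob_def)
next
  case False
  then have "q > 0" using assms by simp
  have "ereal (1 / g) * log_prob q \<le> ereal (- \<beta>) \<longleftrightarrow> ln q \<le> - \<beta> * g"
    using False assms by (simp add: log_prob_def field_simps)
  also have "\<dots> \<longleftrightarrow> q \<le> exp (- \<beta> * g)"
    using \<open>q > 0\<close> by (metis exp_le_cancel_iff exp_ln)
  finally show ?thesis .
qed

lemma scaled_log_prob_ge_iff:
  assumes "g > 0" "0 \<le> q"
  shows "ereal (- \<beta>) \<le> ereal (1 / g) * log_prob q \<longleftrightarrow> exp (- \<beta> * g) \<le> q"
proof (cases "q = 0")
  case True
  then show ?thesis using assms by (simp add: log_prob_def)
next
  case False
  then have "q > 0" using assms by simp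
  have "ereal (- \<beta>) \<le> ereal (1 / g) * log_prob q \<longleftrightarrow> - \<beta> * g \<le> ln q"
    using False assms by (simp add: log_prob_def field_simps)
  also have "\<dots> \<longleftrightarrow> exp (- \<beta> * g) \<le> q"
    using \<open>q > 0\<close> by (metis exp_le_cancel_iff exp_ln)
  finally show ?thesis .
qed

text \<open>
  An LDP upper bound with cost \<open>c\<close> says that the probabilities decay eventually at every exponential rate
  below \<open>c\<close>.  In this form bounds can be added and multiplied without extended-real logarithms.
\<close>

lemma limsup_scaled_log_prob_le_iff:
  fixes c :: ennreal
  assumes "\<And>n. \<gamma> n > 0" "\<And>n. 0 \<le> q n"
  shows "limsup (\<lambda>n. ereal (1 / \<gamma> n) * log_prob (q n)) \<le> - enn2ereal c \<longleftrightarrow>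
    (\<forall>\<beta>. ereal \<beta> < enn2ereal c \<longrightarrow> (\<forall>\<^sub>F n in sequentially. q n \<le> exp (- \<beta> * \<gamma> n)))"
proof -
  have le: "q n \<le> exp (- \<beta> * \<gamma> n) \<longleftrightarrow> ereal (1 / \<gamma> n) * log_prob (q n) \<le> ereal (- \<beta>)" for n \<beta>
    using scaled_log_prob_le_iff[OF assms] by simp
  show ?thesis
    unfolding Limsup_le_iff le
  proof safe
    fix \<beta> assume *: "\<forall>y > - enn2ereal c. \<forall>\<^sub>F n in sequentially. ereal (1 / \<gamma> n) * log_prob (q n) < y"
      and "ereal \<beta> < enn2ereal c"
    then have "- enn2ereal c < ereal (- \<beta>)"
      by (metis ereal_minus_less_minus uminus_ereal.simps(1))
    with * show "\<forall>\<^sub>F n in sequentially. ereal (1 / \<gamma> n) * log_prob (q n) \<le> ereal (- \<beta>)"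
      by (metis (mono_tags, lifting) eventually_mono less_imp_le)
  next
    fix y assume *: "\<forall>\<beta>. ereal \<beta> < enn2ereal c \<longrightarrow>
        (\<forall>\<^sub>F n in sequentially. ereal (1 / \<gamma> n) * log_prob (q n) \<le> ereal (- \<beta>))"
      and "- enn2ereal c < y"
    then obtain r where r: "- enn2ereal c < ereal r" "ereal r < y"
      using ereal_dense2 by blast
    then have "ereal (- r) < enn2ereal c"
      by (metis ereal_uminus_less_reorder uminus_ereal.simps(1))
    with * have "\<forall>\<^sub>F n in sequentially. ereal (1 / \<gamma> n) * log_prob (q n) \<le> ereal r"
      by (metis minus_minus)
    with r show "\<forall>\<^sub>F n in sequentially. ereal (1 / \<gamma> n) * log_prob (q n) < y"
      by (auto elim!: eventually_mono)
  qed
qed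

lemma liminf_scaled_log_prob_ge_iff:
  fixes c :: ennreal
  assumes "\<And>n. \<gamma> n > 0" "\<And>n. 0 \<le> q n"
  shows "- enn2ereal c \<le> liminf (\<lambda>n. ereal (1 / \<gamma> n) * log_prob (q n)) \<longleftrightarrow>
    (\<forall>\<beta>. enn2ereal c < ereal \<beta> \<longrightarrow> (\<forall>\<^sub>F n in sequentially. exp (- \<beta> * \<gamma> n) \<le> q n))"
proof -
  have le: "exp (- \<beta> * \<gamma> n) \<le> q n \<longleftrightarrow> ereal (- \<beta>) \<le> ereal (1 / \<gamma> n) * log_prob (q n)" for n \<beta>
    using scaled_log_prob_ge_iff[OF assms] by simp
  show ?thesis
    unfolding le_Liminf_iff le
  proof safe
    fix \<beta> assume *: "\<forall>y < - enn2ereal c. \<forall>\<^sub>F n in sequentially. y < ereal (1 / \<gamma> n) * log_prob (q n)"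
      and "enn2ereal c < ereal \<beta>"
    then have "ereal (- \<beta>) < - enn2ereal c"
      by (metis ereal_minus_less_minus uminus_ereal.simps(1))
    with * show "\<forall>\<^sub>F n in sequentially. ereal (- \<beta>) \<le> ereal (1 / \<gamma> n) * log_prob (q n)"
      by (metis (mono_tags, lifting) eventually_mono less_imp_le)
  next
    fix y assume *: "\<forall>\<beta>. enn2ereal c < ereal \<beta> \<longrightarrow>
        (\<forall>\<^sub>F n in sequentially. ereal (- \<beta>) \<le> ereal (1 / \<gamma> n) * log_prob (q n))"
      and "y < - enn2ereal c"
    then obtain r where r: "ereal r < - enn2ereal c" "y < ereal r"
      using ereal_dense2 by blast
    then have "enn2ereal c < ereal (- r)"
      by (metis ereal_less_uminus_reorder uminus_ereal.simps(1))
    with * have "\<forall>\<^sub>F n in sequentially. ereal r \<le> ereal (1 / \<gamma> n) * log_prob (q n)"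
      by (metis minus_minus)
    with r show "\<forall>\<^sub>F n in sequentially. y < ereal (1 / \<gamma> n) * log_prob (q n)"
      by (auto elim!: eventually_mono)
  qed
qed

lemma ereal_less_enn2ereal_iff: "0 \<le> \<beta> \<Longrightarrow> ereal \<beta> < enn2ereal c \<longleftrightarrow> ennreal \<beta> < c"
  by (simp add: less_ennreal.rep_eq enn2ereal_ennreal)

lemma enn2ereal_less_ereal_iff: "enn2ereal c < ereal \<beta> \<longleftrightarrow> 0 \<le> \<beta> \<and> c < ennreal \<beta>"
proof (cases "0 \<le> \<beta>")
  case True
  then show ?thesis by (simp add: less_ennreal.rep_eq enn2ereal_ennreal)
next
  case False
  have "0 \<le> enn2ereal c" by simp
  with False show ?thesis
    by (smt (verit) ereal_less_eq(5) leD le_less_trans less_ereal.simps(1) zero_ereal_def)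
qed

text \<open>
  The working form of an LDP.  The lower bound is local: it suffices to compare with the rate at single
  points of the open set.  Negative exponents are left out: no rate lies below them, and a bound on a
  probability that exceeds \<open>1\<close> is trivial.
\<close>

lemma satisfies_LDP_iff:
  assumes "prob_space M" and \<gamma>: "\<And>n. \<gamma> n > 0"
  shows "satisfies_LDP M E Y \<gamma> I \<longleftrightarrow>
    (\<forall>n. Y n \<in> M \<rightarrow>\<^sub>M borel_of E) \<and> rate_function E I \<and>
    (\<forall>\<Theta> x \<beta>. openin E \<Theta> \<longrightarrow> x \<in> \<Theta> \<longrightarrow> 0 \<le> \<beta> \<longrightarrow> I x < ennreal \<beta> \<longrightarrow>
       (\<forall>\<^sub>F n in sequentially. exp (- \<beta> * \<gamma> n) \<le> \<P>(\<omega> in M. Y n \<omega> \<in> \<Theta>))) \<and>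
    (\<forall>\<Gamma> \<beta>. closedin E \<Gamma> \<longrightarrow> 0 \<le> \<beta> \<longrightarrow> ennreal \<beta> < (INF x\<in>\<Gamma>. I x) \<longrightarrow>
       (\<forall>\<^sub>F n in sequentially. \<P>(\<omega> in M. Y n \<omega> \<in> \<Gamma>) \<le> exp (- \<beta> * \<gamma> n)))"
proof (cases "\<forall>n. Y n \<in> M \<rightarrow>\<^sub>M borel_of E")
  case Y: True
  interpret prob_space M by fact
  have ms: "measure (distr M (borel_of E) (Y n)) S = \<P>(\<omega> in M. Y n \<omega> \<in> S)"
    if "S \<in> sets (borel_of E)" for S n
    using Y that by (auto simp: measure_distr intro!: arg_cong[where f="measure M"])
  have lower: "(- enn2ereal (INF x\<in>\<Theta>. I x)
        \<le> liminf (\<lambda>n. ereal (1 / \<gamma> n) * log_prob (measure (distr M (borel_of E) (Y n)) \<Theta>))) \<longleftrightarrow>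
      (\<forall>x \<beta>. x \<in> \<Theta> \<longrightarrow> 0 \<le> \<beta> \<longrightarrow> I x < ennreal \<beta> \<longrightarrow>
       (\<forall>\<^sub>F n in sequentially. exp (- \<beta> * \<gamma> n) \<le> \<P>(\<omega> in M. Y n \<omega> \<in> \<Theta>)))"
    if "openin E \<Theta>" for \<Theta>
    unfolding ms[OF open_in_sets_borel_of[OF that]]
    by (subst liminf_scaled_log_prob_ge_iff[OF \<gamma> measure_nonneg])
       (auto simp: enn2ereal_less_ereal_iff INF_less_iff)
  have upper: "(limsup (\<lambda>n. ereal (1 / \<gamma> n) * log_prob (measure (distr M (borel_of E) (Y n)) \<Gamma>))
          \<le> - enn2ereal (INF x\<in>\<Gamma>. I x)) \<longleftrightarrow>
      (\<forall>\<beta>. 0 \<le> \<beta> \<longrightarrow> ennreal \<beta> < (INF x\<in>\<Gamma>. I x) \<longrightarrow>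
       (\<forall>\<^sub>F n in sequentially. \<P>(\<omega> in M. Y n \<omega> \<in> \<Gamma>) \<le> exp (- \<beta> * \<gamma> n)))"
    if "closedin E \<Gamma>" for \<Gamma>
  proof -
    \<comment> \<open>For a negative exponent the bound exceeds \<open>1\<close>.\<close>
    have neg: "\<P>(\<omega> in M. Y n \<omega> \<in> \<Gamma>) \<le> exp (- \<beta> * \<gamma> n)" if "\<not> 0 \<le> \<beta>" for \<beta> n
    proof -
      have "1 \<le> exp (- \<beta> * \<gamma> n)"
        using \<gamma>[of n] that by (simp add: mult_nonpos_nonneg)
      then show ?thesis using prob_le_1 order_trans by blast
    qed
    show ?thesis
      unfolding ms[OF closed_in_sets_borel_of[OF that]]
      apply (subst limsup_scaled_log_prob_le_iff[OF \<gamma> measure_nonneg])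
      using neg by (metis (mono_tags, lifting) ereal_less_enn2ereal_iff always_eventually)
  qed
  show ?thesis
    unfolding satisfies_LDP_def LDP_def using Y prob_space_distr
    by (simp add: lower upper prob_space_distr cong: imp_cong)
qed (auto simp: satisfies_LDP_def)

section \<open>Pairs of independent sequences\<close>

text \<open>
  Lower semicontinuity, combined with regularity of the space, keeps a rate function above a level on a
  whole closed neighbourhood.  The open set serves to cover compact sets, the closed one to apply the LDP
  upper bound.  The alternative \<open>r = 0\<close> is for points of rate \<open>0\<close>, which have no level strictly below.
\<close>

lemma rate_function_closed_nbhd:
  assumes rate: "rate_function E I" and reg: "regular_space E" and x: "x \<in> topspace E"
    and r: "r = 0 \<or> r < I x"
  obtains U C where "openin E U" "closedin E C" "x \<in> U" "U \<subseteq> C" "\<And>u. u \<in> C \<Longrightarrow> r \<le> I u"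
proof (cases "r = 0")
  case True
  with x show ?thesis by (intro that[of "topspace E" "topspace E"]) auto
next
  case False
  have "openin E (topspace E - {u \<in> topspace E. I u \<le> r})"
    using rate by (simp add: rate_function_def openin_diff)
  moreover have "x \<in> topspace E - {u \<in> topspace E. I u \<le> r}"
    using x r False by auto
  moreover have "neighbourhood_base_of (closedin E) E"
    using reg by (simp add: neighbourhood_base_of_closedin)
  ultimately obtain U C where "openin E U" "closedin E C" "x \<in> U" "U \<subseteq> C"
      "C \<subseteq> topspace E - {u \<in> topspace E. I u \<le> r}"
    unfolding neighbourhood_base_of by meson
  with that[of U C] show ?thesis by force
qed

text \<open>
  Turns a lower bound on the total cost of a pair into lower bounds for its two components.  A summand that vanishes has
  no number strictly below it, so its share is \<open>0\<close>.
\<close>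

lemma ennreal_less_add_split:
  fixes a x y :: ennreal
  assumes "a < x + y"
  obtains r s where "0 \<le> r" "0 \<le> s" "a < ennreal (r + s)"
    "ennreal r = 0 \<or> ennreal r < x" "ennreal s = 0 \<or> ennreal s < y"
proof -
  have *: "\<exists>r\<ge>0. (ennreal r = 0 \<or> ennreal r < u) \<and> a < ennreal r + b"
    if "a < u + b" for u b :: ennreal
  proof (cases "u = 0")
    case True
    with that show ?thesis by (intro exI[of _ 0]) auto
  next
    case False
    \<comment> \<open>Addition is continuous from the left, so \<open>u\<close> can be replaced by some \<open>r < u\<close>.\<close>
    have u: "u = (SUP r\<in>{r. r < u}. r)"
    proof (rule antisym)
      show "u \<le> (SUP r\<in>{r. r < u}. r)"
        by (rule dense_le, rule SUP_upper2) auto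
      show "(SUP r\<in>{r. r < u}. r) \<le> u"
        by (rule SUP_least) auto
    qed
    have "u + b = (SUP r\<in>{r. r < u}. r + b)"
      by (subst u, subst ennreal_SUP_add_left) (use False in \<open>auto simp: zero_less_iff_neq_zero[symmetric]\<close>)
    with that obtain r where r: "r < u" "a < r + b"
      by (auto simp: less_SUP_iff)
    then have "r < top" using top.not_eq_extremum by fastforce
    then have "ennreal (enn2real r) = r" by simp
    with r show ?thesis by (intro exI[of _ "enn2real r"]) auto
  qed
  obtain r where r: "r \<ge> 0" "ennreal r = 0 \<or> ennreal r < x" "a < y + ennreal r"
    using *[OF assms] by (metis add.commute)
  obtain s where s: "s \<ge> 0" "ennreal s = 0 \<or> ennreal s < y" "a < ennreal s + ennreal r"
    using *[OF r(3)] by blast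
  show ?thesis
    using r s by (intro that[of r s]) (auto simp: ennreal_plus add.commute)
qed

text \<open>
  Constant factors, such as the number of boxes in a finite cover, disappear on the exponential scale.
\<close>

lemma eventually_mult_exp_le:
  fixes \<gamma> :: "nat \<Rightarrow> real"
  assumes "filterlim \<gamma> at_top sequentially" "\<beta> < \<beta>'"
  shows "\<forall>\<^sub>F n in sequentially. c * exp (- \<beta>' * \<gamma> n) \<le> exp (- \<beta> * \<gamma> n)"
proof -
  have "\<forall>\<^sub>F n in sequentially. \<gamma> n \<ge> \<bar>c\<bar> / (\<beta>' - \<beta>)"
    using assms(1) by (simp add: filterlim_at_top)
  then show ?thesis
  proof (rule eventually_mono)
    fix n assume "\<gamma> n \<ge> \<bar>c\<bar> / (\<beta>' - \<beta>)"
    then have "c \<le> (\<beta>' - \<beta>) * \<gamma> n"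
      using assms(2) by (simp add: field_simps)
    also have "\<dots> \<le> exp ((\<beta>' - \<beta>) * \<gamma> n)"
      using exp_ge_add_one_self[of "(\<beta>' - \<beta>) * \<gamma> n"] by linarith
    finally have "c * exp (- \<beta>' * \<gamma> n) \<le> exp ((\<beta>' - \<beta>) * \<gamma> n) * exp (- \<beta>' * \<gamma> n)"
      by (rule mult_right_mono) simp
    also have "\<dots> = exp (- \<beta> * \<gamma> n)"
      by (simp add: exp_add[symmetric] algebra_simps)
    finally show "c * exp (- \<beta>' * \<gamma> n) \<le> exp (- \<beta> * \<gamma> n)" .
  qed
qed

lemma rate_function_add:
  assumes rate: "rate_function E1 I1" "rate_function E2 I2"
    and reg: "regular_space E1" "regular_space E2"
  shows "rate_function (prod_topology E1 E2) (\<lambda>(x, y). I1 x + I2 y)"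
  unfolding rate_function_def
proof
  fix a
  let ?E = "prod_topology E1 E2" and ?I = "\<lambda>(x, y). I1 x + I2 y"
  have "openin ?E (topspace ?E - {p \<in> topspace ?E. ?I p \<le> a})"
  proof (subst openin_subopen, intro ballI)
    fix p assume p: "p \<in> topspace ?E - {p \<in> topspace ?E. ?I p \<le> a}"
    obtain x y where xy: "p = (x, y)" by (cases p)
    have "x \<in> topspace E1" "y \<in> topspace E2" "a < I1 x + I2 y"
      using p by (auto simp: xy)
    from ennreal_less_add_split[OF this(3)] obtain r s where rs: "0 \<le> r" "0 \<le> s"
      "a < ennreal (r + s)" "ennreal r = 0 \<or> ennreal r < I1 x" "ennreal s = 0 \<or> ennreal s < I2 y" .
    obtain U C where U: "openin E1 U" "closedin E1 C" "x \<in> U" "U \<subseteq> C" "\<And>u. u \<in> C \<Longrightarrow> ennreal r \<le> I1 u"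
      by (rule rate_function_closed_nbhd[OF rate(1) reg(1) \<open>x \<in> topspace E1\<close> rs(4)]) blast
    obtain V D where V: "openin E2 V" "closedin E2 D" "y \<in> V" "V \<subseteq> D" "\<And>u. u \<in> D \<Longrightarrow> ennreal s \<le> I2 u"
      by (rule rate_function_closed_nbhd[OF rate(2) reg(2) \<open>y \<in> topspace E2\<close> rs(5)]) blast
    have "a < I1 u + I2 v" if "u \<in> U" "v \<in> V" for u v
    proof -
      have "ennreal (r + s) \<le> I1 u + I2 v"
        using add_mono[OF U(5) V(5)] rs(1,2) U(4) V(4) that by (simp add: subset_eq)
      with rs(3) show ?thesis by (rule less_le_trans)
    qed
    moreover have "openin ?E (U \<times> V)"
      using U V by (simp add: openin_prod_Times_iff)
    ultimately show "\<exists>W. openin ?E W \<and> p \<in> W \<and>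
        W \<subseteq> topspace ?E - {p \<in> topspace ?E. ?I p \<le> a}"
      using U(3) V(3) openin_subset[of ?E "U \<times> V"]
      by (intro exI[of _ "U \<times> V"]) (fastforce simp: not_le xy)
  qed
  then show "closedin ?E {p \<in> topspace ?E. ?I p \<le> a}"
    by (simp add: closedin_def)
qed

lemma good_rate_function_add:
  assumes good: "good_rate_function E1 I1" "good_rate_function E2 I2"
    and reg: "regular_space E1" "regular_space E2"
  shows "good_rate_function (prod_topology E1 E2) (\<lambda>(x, y). I1 x + I2 y)"
proof -
  let ?E = "prod_topology E1 E2" and ?I = "\<lambda>(x, y). I1 x + I2 y"
  have rate: "rate_function ?E ?I"
    using good reg by (intro rate_function_add) (auto simp: good_rate_function_def)
  have "compactin ?E {p \<in> topspace ?E. ?I p \<le> ennreal a}" if "a \<ge> 0" for a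
  proof (rule closed_compactin)
    show "compactin ?E ({x \<in> topspace E1. I1 x \<le> ennreal a} \<times> {y \<in> topspace E2. I2 y \<le> ennreal a})"
      using good that by (simp add: compactin_Times good_rate_function_def)
    show "{p \<in> topspace ?E. ?I p \<le> ennreal a} \<subseteq>
        {x \<in> topspace E1. I1 x \<le> ennreal a} \<times> {y \<in> topspace E2. I2 y \<le> ennreal a}"
      by (auto intro: order_trans[rotated])
    show "closedin ?E {p \<in> topspace ?E. ?I p \<le> ennreal a}"
      using rate by (simp add: rate_function_def)
  qed
  with rate show ?thesis by (simp add: good_rate_function_def)
qed

lemma satisfies_LDP_eventually_le:
  assumes M: "prob_space M" and \<gamma>: "\<And>n. \<gamma> n > 0"
    and LDP: "satisfies_LDP M E Y \<gamma> I"
    and C: "closedin E C" and r: "\<And>x. x \<in> C \<Longrightarrow> ennreal r \<le> I x" and "\<beta> < r"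
  shows "\<forall>\<^sub>F n in sequentially. \<P>(\<omega> in M. Y n \<omega> \<in> C) \<le> exp (- \<beta> * \<gamma> n)"
proof (cases "0 \<le> \<beta>")
  case True
  then have "ennreal \<beta> < ennreal r"
    using \<open>\<beta> < r\<close> by (simp add: ennreal_lessI)
  also have "ennreal r \<le> (INF x\<in>C. I x)"
    using r by (intro INF_greatest)
  finally show ?thesis
    using LDP C True unfolding satisfies_LDP_iff[OF M \<gamma>] by blast
next
  case False
  interpret prob_space M by fact
  have "1 \<le> exp (- \<beta> * \<gamma> n)" for n
    using \<gamma>[of n] False by (simp add: mult_nonpos_nonneg)
  then show ?thesis
    by (intro always_eventually allI) (meson order_trans prob_le_1)
qed

text \<open>
  For the lower bound, an open box inside the given open set has as probability the product of two
  probabilities.  For the upper bound let \<open>b\<close> be a cost below the infimum over the closed set \<open>\<Gamma>\<close>.  Goodness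
  makes the level sets \<open>K1\<close> and \<open>K2\<close> at height \<open>b\<close> compact, so \<open>K1 \<times> K2\<close> is covered by finitely many open
  sets whose part in \<open>\<Gamma>\<close> has probability at most \<open>exp (- b \<gamma>\<^sub>n)\<close>.  By Wallace's theorem the cover
  contains an open box \<open>G1 \<times> G2\<close> around \<open>K1 \<times> K2\<close>, and leaving it forces one of the components out of its
  level set, at cost at least \<open>b\<close>.
\<close>

lemma satisfies_LDP_independent_pair:
  assumes M: "prob_space M" and \<gamma>: "\<And>n. \<gamma> n > 0" and \<gamma>_lim: "filterlim \<gamma> at_top sequentially"
    and LDP1: "satisfies_LDP M E1 Y1 \<gamma> I1" and LDP2: "satisfies_LDP M E2 Y2 \<gamma> I2"
    and good1: "good_rate_function E1 I1" and good2: "good_rate_function E2 I2"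
    and reg: "regular_space E1" "regular_space E2"
    and sc: "second_countable E1" "second_countable E2"
    and indep: "\<And>n D1 D2. D1 \<in> sets (borel_of E1) \<Longrightarrow> D2 \<in> sets (borel_of E2) \<Longrightarrow>
       \<P>(\<omega> in M. Y1 n \<omega> \<in> D1 \<and> Y2 n \<omega> \<in> D2) = \<P>(\<omega> in M. Y1 n \<omega> \<in> D1) * \<P>(\<omega> in M. Y2 n \<omega> \<in> D2)"
  shows "satisfies_LDP M (prod_topology E1 E2) (\<lambda>n \<omega>. (Y1 n \<omega>, Y2 n \<omega>)) \<gamma> (\<lambda>(x, y). I1 x + I2 y)"
proof -
  interpret prob_space M by fact
  let ?E = "prod_topology E1 E2" and ?I = "\<lambda>(x, y). I1 x + I2 y"
  note L1 = LDP1[unfolded satisfies_LDP_iff[OF M \<gamma>]] and L2 = LDP2[unfolded satisfies_LDP_iff[OF M \<gamma>]]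
  have Y1: "Y1 n \<in> M \<rightarrow>\<^sub>M borel_of E1" and Y2: "Y2 n \<in> M \<rightarrow>\<^sub>M borel_of E2" for n
    using L1 L2 by auto
  have Y [measurable]: "(\<lambda>\<omega>. (Y1 n \<omega>, Y2 n \<omega>)) \<in> M \<rightarrow>\<^sub>M borel_of ?E" for n
    using measurable_pair_borel_of[OF sc Y1 Y2] .
  have ev: "{\<omega> \<in> space M. (Y1 n \<omega>, Y2 n \<omega>) \<in> S} \<in> sets M" if "S \<in> sets (borel_of ?E)" for S n
    using that by measurable
  have ev1: "{\<omega> \<in> space M. Y1 n \<omega> \<in> S} \<in> sets M" if "S \<in> sets (borel_of E1)" for S n
    using that Y1 by measurable
  have ev2: "{\<omega> \<in> space M. Y2 n \<omega> \<in> S} \<in> sets M" if "S \<in> sets (borel_of E2)" for S n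
    using that Y2 by measurable
  have rate1: "rate_function E1 I1" and rate2: "rate_function E2 I2"
    using L1 L2 by auto
  have rate: "rate_function ?E ?I"
    by (rule rate_function_add[OF rate1 rate2 reg])
  have lower: "\<forall>\<^sub>F n in sequentially. exp (- \<beta> * \<gamma> n) \<le> \<P>(\<omega> in M. (Y1 n \<omega>, Y2 n \<omega>) \<in> \<Theta>)"
    if \<Theta>: "openin ?E \<Theta>" and xy: "(x, y) \<in> \<Theta>" and "0 \<le> \<beta>" and less: "I1 x + I2 y < ennreal \<beta>" for \<Theta> x y \<beta>
  proof -
    obtain U V where UV: "openin E1 U" "openin E2 V" "x \<in> U" "y \<in> V" "U \<times> V \<subseteq> \<Theta>"
      using \<Theta> xy unfolding openin_prod_topology_alt by metis
    have "I1 x < top" "I2 y < top"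
      using less by (auto simp: less_top[symmetric] dest: less_trans)
    then obtain u v where u: "I1 x = ennreal u" "0 \<le> u" and v: "I2 y = ennreal v" "0 \<le> v"
      by (metis ennreal_cases infinity_ennreal_def less_irrefl)
    \<comment> \<open>Half of the slack in \<open>I1 x + I2 y < \<beta>\<close> goes to each component.\<close>
    define \<delta> where "\<delta> = (\<beta> - u - v) / 2"
    have "u + v < \<beta>"
      using less u v \<open>0 \<le> \<beta>\<close> by (metis ennreal_less_iff ennreal_plus add_nonneg_nonneg)
    then have \<delta>: "\<delta> > 0" "\<beta> = (u + \<delta>) + (v + \<delta>)" by (auto simp: \<delta>_def field_simps)
    have "I1 x < ennreal (u + \<delta>)" "I2 y < ennreal (v + \<delta>)"
      using \<delta>(1) u v by (auto simp: ennreal_less_iff simp del: ennreal_plus)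
    then have "\<forall>\<^sub>F n in sequentially. exp (- (u + \<delta>) * \<gamma> n) \<le> \<P>(\<omega> in M. Y1 n \<omega> \<in> U)"
      "\<forall>\<^sub>F n in sequentially. exp (- (v + \<delta>) * \<gamma> n) \<le> \<P>(\<omega> in M. Y2 n \<omega> \<in> V)"
      using L1 L2 UV u v \<delta> by (meson add_nonneg_nonneg less_imp_le)+
    then show ?thesis
    proof eventually_elim
      case (elim n)
      have "exp (- \<beta> * \<gamma> n) = exp (- (u + \<delta>) * \<gamma> n) * exp (- (v + \<delta>) * \<gamma> n)"
        unfolding \<delta>(2) exp_add[symmetric] by (simp add: algebra_simps)
      also have "\<dots> \<le> \<P>(\<omega> in M. Y1 n \<omega> \<in> U) * \<P>(\<omega> in M. Y2 n \<omega> \<in> V)"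
        using elim by (intro mult_mono) auto
      also have "\<dots> = \<P>(\<omega> in M. Y1 n \<omega> \<in> U \<and> Y2 n \<omega> \<in> V)"
        using UV by (intro indep[symmetric] open_in_sets_borel_of)
      also have "\<dots> \<le> \<P>(\<omega> in M. (Y1 n \<omega>, Y2 n \<omega>) \<in> \<Theta>)"
        using UV(5) \<Theta> by (intro finite_measure_mono ev open_in_sets_borel_of) auto
      finally show ?case .
    qed
  qed
  have upper: "\<forall>\<^sub>F n in sequentially. \<P>(\<omega> in M. (Y1 n \<omega>, Y2 n \<omega>) \<in> \<Gamma>) \<le> exp (- \<beta> * \<gamma> n)"
    if \<Gamma>: "closedin ?E \<Gamma>" and "0 \<le> \<beta>" and less: "ennreal \<beta> < (INF p\<in>\<Gamma>. ?I p)" for \<Gamma> \<beta>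
  proof -
    obtain z where z: "ennreal \<beta> < z" "z < (INF p\<in>\<Gamma>. ?I p)"
      using dense[OF less] by auto
    then have "z < top" by (metis less_top top.extremum_strict)
    define b where "b = enn2real z"
    have b: "z = ennreal b" "0 \<le> b"
      using \<open>z < top\<close> by (auto simp: b_def)
    have "\<beta> < b" using z(1) b \<open>0 \<le> \<beta>\<close> by (simp add: ennreal_less_iff)
    define K1 where "K1 = {x \<in> topspace E1. I1 x \<le> ennreal b}"
    define K2 where "K2 = {x \<in> topspace E2. I2 x \<le> ennreal b}"
    have K: "compactin E1 K1" "compactin E2 K2"
      using good1 good2 b by (auto simp: good_rate_function_def K1_def K2_def)
    define \<W> where "\<W> = {W. openin ?E W \<and>
      (\<forall>\<^sub>F n in sequentially. \<P>(\<omega> in M. (Y1 n \<omega>, Y2 n \<omega>) \<in> W \<inter> \<Gamma>) \<le> exp (- b * \<gamma> n))}"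
    have "\<exists>W\<in>\<W>. (x, y) \<in> W" if xy: "(x, y) \<in> topspace ?E" for x y
    proof (cases "(x, y) \<in> \<Gamma>")
      case False
      have "topspace ?E - \<Gamma> \<in> \<W>"
        using \<Gamma> openin_diff[OF openin_topspace \<Gamma>] by (simp add: \<W>_def)
      then show ?thesis by (rule bexI[rotated]) (use False xy in simp)
    next
      case True
      have "ennreal b < I1 x + I2 y"
        using z(2) INF_lower[OF True, of ?I] unfolding b by (auto intro: less_le_trans)
      from ennreal_less_add_split[OF this] obtain r s where rs: "0 \<le> r" "0 \<le> s"
        "ennreal b < ennreal (r + s)" "ennreal r = 0 \<or> ennreal r < I1 x"
        "ennreal s = 0 \<or> ennreal s < I2 y" .
      have "x \<in> topspace E1" "y \<in> topspace E2" using xy by auto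
      obtain U C where U: "openin E1 U" "closedin E1 C" "x \<in> U" "U \<subseteq> C"
          "\<And>u. u \<in> C \<Longrightarrow> ennreal r \<le> I1 u"
        by (rule rate_function_closed_nbhd[OF rate1 reg(1) \<open>x \<in> topspace E1\<close> rs(4)]) blast
      obtain V D where V: "openin E2 V" "closedin E2 D" "y \<in> V" "V \<subseteq> D"
          "\<And>u. u \<in> D \<Longrightarrow> ennreal s \<le> I2 u"
        by (rule rate_function_closed_nbhd[OF rate2 reg(2) \<open>y \<in> topspace E2\<close> rs(5)]) blast
      \<comment> \<open>Decay is guaranteed only at rates strictly below \<open>r\<close> and \<open>s\<close>; the slack in \<open>b < r + s\<close> pays for that.\<close>
      define \<delta> where "\<delta> = (r + s - b) / 2"
      have "b < r + s" using rs(1-3) b(2) by (simp add: ennreal_less_iff del: ennreal_plus)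
      then have \<delta>: "r - \<delta> < r" "s - \<delta> < s" "b = (r - \<delta>) + (s - \<delta>)"
        by (auto simp: \<delta>_def field_simps)
      have "\<forall>\<^sub>F n in sequentially. \<P>(\<omega> in M. Y1 n \<omega> \<in> C) \<le> exp (- (r - \<delta>) * \<gamma> n)"
        using U(5) by (rule satisfies_LDP_eventually_le[OF M \<gamma> LDP1 U(2) _ \<delta>(1)])
      moreover have "\<forall>\<^sub>F n in sequentially. \<P>(\<omega> in M. Y2 n \<omega> \<in> D) \<le> exp (- (s - \<delta>) * \<gamma> n)"
        using V(5) by (rule satisfies_LDP_eventually_le[OF M \<gamma> LDP2 V(2) _ \<delta>(2)])
      ultimately have "\<forall>\<^sub>F n in sequentially. \<P>(\<omega> in M. (Y1 n \<omega>, Y2 n \<omega>) \<in> (U \<times> V) \<inter> \<Gamma>) \<le> exp (- b * \<gamma> n)"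
      proof eventually_elim
        case (elim n)
        have "{\<omega> \<in> space M. Y1 n \<omega> \<in> C \<and> Y2 n \<omega> \<in> D} \<in> sets M"
          using ev1[OF closed_in_sets_borel_of[OF U(2)], of n]
            ev2[OF closed_in_sets_borel_of[OF V(2)], of n] by (simp add: sets.sets_Collect_conj)
        then have "\<P>(\<omega> in M. (Y1 n \<omega>, Y2 n \<omega>) \<in> (U \<times> V) \<inter> \<Gamma>)
            \<le> \<P>(\<omega> in M. Y1 n \<omega> \<in> C \<and> Y2 n \<omega> \<in> D)"
          using U(4) V(4) by (intro finite_measure_mono) auto
        also have "\<dots> = \<P>(\<omega> in M. Y1 n \<omega> \<in> C) * \<P>(\<omega> in M. Y2 n \<omega> \<in> D)"
          using U V by (intro indep closed_in_sets_borel_of)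
        also have "\<dots> \<le> exp (- (r - \<delta>) * \<gamma> n) * exp (- (s - \<delta>) * \<gamma> n)"
          using elim by (intro mult_mono) auto
        also have "\<dots> = exp (- b * \<gamma> n)"
          unfolding \<delta>(3) exp_add[symmetric] by (simp add: algebra_simps)
        finally show ?case .
      qed
      moreover have "openin ?E (U \<times> V)" using U V by (simp add: openin_prod_Times_iff)
      ultimately have "U \<times> V \<in> \<W>" by (simp add: \<W>_def)
      then show ?thesis by (rule bexI[rotated]) (use U(3) V(3) in simp)
    qed
    then have "K1 \<times> K2 \<subseteq> \<Union>\<W>"
      by (fastforce simp: K1_def K2_def)
    then obtain \<F> where \<F>: "finite \<F>" "\<F> \<subseteq> \<W>" "K1 \<times> K2 \<subseteq> \<Union>\<F>"
      using compactinD[of ?E "K1 \<times> K2" \<W>] K by (auto simp: compactin_Times \<W>_def)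
    have \<F>_open: "openin ?E W" if "W \<in> \<F>" for W using \<F>(2) that by (auto simp: \<W>_def)
    then have "openin ?E (\<Union>\<F>)" by blast
    then obtain G1 G2 where G: "openin E1 G1" "openin E2 G2" "K1 \<subseteq> G1" "K2 \<subseteq> G2" "G1 \<times> G2 \<subseteq> \<Union>\<F>"
      using Wallace_theorem_prod_topology[OF K _ \<F>(3)] by metis
    \<comment> \<open>A rate strictly between \<open>\<beta>\<close> and \<open>b\<close>: the events outside \<open>G1 \<times> G2\<close> decay only at rates below \<open>b\<close>, and the
      number of events is absorbed in passing from \<open>b'\<close> to \<open>\<beta>\<close>.\<close>
    define b' where "b' = (\<beta> + b) / 2"
    have b': "\<beta> < b'" "b' < b" using \<open>\<beta> < b\<close> by (auto simp: b'_def)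
    have "\<forall>\<^sub>F n in sequentially. \<P>(\<omega> in M. Y1 n \<omega> \<in> topspace E1 - G1) \<le> exp (- b' * \<gamma> n)"
      using G by (intro satisfies_LDP_eventually_le[OF M \<gamma> LDP1 _ _ b'(2)]) (auto simp: K1_def)
    moreover have "\<forall>\<^sub>F n in sequentially. \<P>(\<omega> in M. Y2 n \<omega> \<in> topspace E2 - G2) \<le> exp (- b' * \<gamma> n)"
      using G by (intro satisfies_LDP_eventually_le[OF M \<gamma> LDP2 _ _ b'(2)]) (auto simp: K2_def)
    moreover have "\<forall>\<^sub>F n in sequentially. \<forall>W\<in>\<F>.
        \<P>(\<omega> in M. (Y1 n \<omega>, Y2 n \<omega>) \<in> W \<inter> \<Gamma>) \<le> exp (- b * \<gamma> n)"
      using \<F> by (intro eventually_ball_finite) (auto simp: \<W>_def)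
    moreover have "\<forall>\<^sub>F n in sequentially. (2 + real (card \<F>)) * exp (- b' * \<gamma> n) \<le> exp (- \<beta> * \<gamma> n)"
      by (rule eventually_mult_exp_le[OF \<gamma>_lim b'(1)])
    ultimately show ?thesis
    proof eventually_elim
      case (elim n)
      let ?A1 = "{\<omega> \<in> space M. Y1 n \<omega> \<in> topspace E1 - G1}"
      let ?A2 = "{\<omega> \<in> space M. Y2 n \<omega> \<in> topspace E2 - G2}"
      let ?A3 = "\<lambda>W. {\<omega> \<in> space M. (Y1 n \<omega>, Y2 n \<omega>) \<in> W \<inter> \<Gamma>}"
      have A1: "?A1 \<in> sets M"
        using G(1) by (intro ev1 closed_in_sets_borel_of closedin_diff closedin_topspace)
      have A2: "?A2 \<in> sets M"
        using G(2) by (intro ev2 closed_in_sets_borel_of closedin_diff closedin_topspace)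
      have A3: "?A3 W \<in> sets M" if "W \<in> \<F>" for W
        using \<F>_open[OF that] \<Gamma>
        by (intro ev sets.Int open_in_sets_borel_of closed_in_sets_borel_of)
      note A = A1 A2 A3
      have "prob {\<omega> \<in> space M. (Y1 n \<omega>, Y2 n \<omega>) \<in> \<Gamma>} \<le> prob (?A1 \<union> ?A2 \<union> (\<Union>W\<in>\<F>. ?A3 W))"
      proof (rule finite_measure_mono)
        show "{\<omega> \<in> space M. (Y1 n \<omega>, Y2 n \<omega>) \<in> \<Gamma>} \<subseteq> ?A1 \<union> ?A2 \<union> (\<Union>W\<in>\<F>. ?A3 W)"
          using G(5) measurable_space[OF Y1] measurable_space[OF Y2] by auto
      qed (use A \<F>(1) in auto)
      also have "\<dots> \<le> prob (?A1 \<union> ?A2) + prob (\<Union>W\<in>\<F>. ?A3 W)"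
        using A \<F>(1) by (intro measure_Un_le) auto
      also have "\<dots> \<le> (prob ?A1 + prob ?A2) + (\<Sum>W\<in>\<F>. prob (?A3 W))"
        using A \<F>(1) by (intro add_mono measure_Un_le measure_UNION_le) auto
      also have "\<dots> \<le> (exp (- b' * \<gamma> n) + exp (- b' * \<gamma> n)) + (\<Sum>W\<in>\<F>. exp (- b' * \<gamma> n))"
      proof (intro add_mono sum_mono)
        fix W assume "W \<in> \<F>"
        then have "prob (?A3 W) \<le> exp (- b * \<gamma> n)" using elim by blast
        also have "\<dots> \<le> exp (- b' * \<gamma> n)" using b'(2) \<gamma>[of n] by simp
        finally show "prob (?A3 W) \<le> exp (- b' * \<gamma> n)" .
      qed (use elim in auto)
      also have "\<dots> = (2 + real (card \<F>)) * exp (- b' * \<gamma> n)"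
        by (simp add: algebra_simps)
      also have "\<dots> \<le> exp (- \<beta> * \<gamma> n)" using elim by simp
      finally show ?case .
    qed
  qed
  show ?thesis
    unfolding satisfies_LDP_iff[OF M \<gamma>]
  proof (intro conjI allI impI)
    fix \<Theta> p \<beta>
    assume "openin ?E \<Theta>" "p \<in> \<Theta>" "0 \<le> \<beta>" "?I p < ennreal \<beta>"
    then show "\<forall>\<^sub>F n in sequentially. exp (- \<beta> * \<gamma> n) \<le> \<P>(\<omega> in M. (Y1 n \<omega>, Y2 n \<omega>) \<in> \<Theta>)"
      using lower[of \<Theta> "fst p" "snd p" \<beta>] by (simp add: case_prod_beta)
  qed (fact Y rate upper)+
qed
section \<open>The contraction principle\<close>

text \<open>
  The bounds transfer because preimages of open and closed sets are open and closed.  Goodness of \<open>I\<close> is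
  needed for \<open>I'\<close> to be a good rate function: the level set of \<open>I'\<close> at height \<open>a\<close> is the intersection, over
  all \<open>c > a\<close>, of the images of the level sets of \<open>I\<close>, and these images are compact.  An infimum
  that is at most \<open>a\<close> only provides preimages of rate below \<open>c\<close>, for each \<open>c > a\<close>; hence the intersection.
\<close>

lemma contraction_principle:
  assumes M: "prob_space M" and \<gamma>: "\<And>n. \<gamma> n > 0"
    and LDP: "satisfies_LDP M E Y \<gamma> I" and good: "good_rate_function E I"
    and f: "continuous_map E F f" and F: "Hausdorff_space F"
    and I': "\<And>y. y \<in> topspace F \<Longrightarrow> I' y = (INF x\<in>{x \<in> topspace E. f x = y}. I x)"
  shows "good_rate_function F I'" and "satisfies_LDP M F (\<lambda>n \<omega>. f (Y n \<omega>)) \<gamma> I'"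
proof -
  note L = LDP[unfolded satisfies_LDP_iff[OF M \<gamma>]]
  have Y: "Y n \<in> M \<rightarrow>\<^sub>M borel_of E" for n using L by auto
  have Y_top: "Y n \<omega> \<in> topspace E" if "\<omega> \<in> space M" for n \<omega>
    using measurable_space[OF Y that] by simp
  have f_top: "f x \<in> topspace F" if "x \<in> topspace E" for x
    using continuous_map_funspace[OF f] that by auto
  define K where "K c = f ` {x \<in> topspace E. I x \<le> ennreal c}" for c
  have K: "compactin F (K c)" if "0 \<le> c" for c
    unfolding K_def using good that by (intro image_compactin[OF _ f]) (auto simp: good_rate_function_def)
  have K_closed: "closedin F (K c)" if "0 \<le> c" for c
    using compactin_imp_closedin[OF F K[OF that]] .
  have level: "{y \<in> topspace F. I' y \<le> ennreal a} = (\<Inter>c\<in>{a<..}. K c)" if "0 \<le> a" for a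
  proof (intro set_eqI iffI)
    fix y assume y: "y \<in> {y \<in> topspace F. I' y \<le> ennreal a}"
    show "y \<in> (\<Inter>c\<in>{a<..}. K c)"
    proof
      fix c assume "c \<in> {a<..}"
      then have "I' y < ennreal c" using y \<open>0 \<le> a\<close> by (auto intro: le_less_trans ennreal_lessI)
      then obtain x where "x \<in> topspace E" "f x = y" "I x < ennreal c"
        using y I' by (auto simp: INF_less_iff)
      then show "y \<in> K c" unfolding K_def by (intro image_eqI[of _ _ x]) auto
    qed
  next
    fix y assume y: "y \<in> (\<Inter>c\<in>{a<..}. K c)"
    then have "y \<in> K (a + 1)" by auto
    then have "y \<in> topspace F" using f_top by (auto simp: K_def)
    have *: "I' y \<le> ennreal c" if "a < c" for c
    proof -
      from y that obtain x where "x \<in> topspace E" "f x = y" "I x \<le> ennreal c"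
        by (auto simp: K_def)
      then show ?thesis
        unfolding I'[OF \<open>y \<in> topspace F\<close>] by (intro INF_lower2[of x]) auto
    qed
    have "I' y \<le> ennreal a"
    proof (rule ennreal_le_epsilon)
      fix e :: real assume "0 < e"
      then show "I' y \<le> ennreal a + ennreal e"
        using *[of "a + e"] \<open>0 \<le> a\<close> by simp
    qed
    with \<open>y \<in> topspace F\<close> show "y \<in> {y \<in> topspace F. I' y \<le> ennreal a}" by simp
  qed
  have closed: "closedin F {y \<in> topspace F. I' y \<le> a}" for a
  proof (cases a)
    case (real r)
    show ?thesis
      unfolding \<open>a = ennreal r\<close> level[OF \<open>0 \<le> r\<close>] using \<open>0 \<le> r\<close>
      by (intro closedin_INT K_closed) (auto simp: gt_ex)
  qed simp
  then have rate: "rate_function F I'" by (simp add: rate_function_def)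
  have "compactin F {y \<in> topspace F. I' y \<le> ennreal a}" if "0 \<le> a" for a
  proof (rule closed_compactin)
    show "compactin F (K (a + 1))" using that by (intro K) auto
    show "{y \<in> topspace F. I' y \<le> ennreal a} \<subseteq> K (a + 1)" unfolding level[OF that] by auto
  qed (fact closed)
  with rate show "good_rate_function F I'" by (simp add: good_rate_function_def)
  have P: "\<P>(\<omega> in M. f (Y n \<omega>) \<in> S) = \<P>(\<omega> in M. Y n \<omega> \<in> {x \<in> topspace E. f x \<in> S})" for n S
    using Y_top by (intro arg_cong[where f="measure M"]) auto
  show "satisfies_LDP M F (\<lambda>n \<omega>. f (Y n \<omega>)) \<gamma> I'"
    unfolding satisfies_LDP_iff[OF M \<gamma>] P
  proof (intro conjI allI impI)
    show "(\<lambda>\<omega>. f (Y n \<omega>)) \<in> M \<rightarrow>\<^sub>M borel_of F" for n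
      using measurable_compose[OF Y continuous_map_measurable_borel_of[OF f]] .
  next
    fix \<Theta> y \<beta>
    assume *: "openin F \<Theta>" "y \<in> \<Theta>" "0 \<le> \<beta>" "I' y < ennreal \<beta>"
    then have "y \<in> topspace F" using openin_subset by blast
    with * obtain x where x: "x \<in> topspace E" "f x = y" "I x < ennreal \<beta>"
      using I' by (auto simp: INF_less_iff)
    have "openin E {x \<in> topspace E. f x \<in> \<Theta>}"
      using openin_continuous_map_preimage[OF f *(1)] .
    with x * L show "\<forall>\<^sub>F n in sequentially.
        exp (- \<beta> * \<gamma> n) \<le> \<P>(\<omega> in M. Y n \<omega> \<in> {x \<in> topspace E. f x \<in> \<Theta>})"
      by blast
  next
    fix \<Gamma> \<beta>
    assume *: "closedin F \<Gamma>" "0 \<le> \<beta>" "ennreal \<beta> < (INF y\<in>\<Gamma>. I' y)"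
    have "(INF y\<in>\<Gamma>. I' y) \<le> (INF x\<in>{x \<in> topspace E. f x \<in> \<Gamma>}. I x)"
    proof (rule INF_greatest)
      fix x assume x: "x \<in> {x \<in> topspace E. f x \<in> \<Gamma>}"
      then have "I' (f x) \<le> I x"
        using I'[OF f_top[of x]] by (auto intro: INF_lower)
      then show "(INF y\<in>\<Gamma>. I' y) \<le> I x"
        using x by (auto intro: INF_lower2[of "f x"])
    qed
    then have "ennreal \<beta> < (INF x\<in>{x \<in> topspace E. f x \<in> \<Gamma>}. I x)"
      using *(3) by (rule less_le_trans[rotated])
    moreover have "closedin E {x \<in> topspace E. f x \<in> \<Gamma>}"
      using closedin_continuous_map_preimage[OF f *(1)] .
    ultimately show "\<forall>\<^sub>F n in sequentially.
        \<P>(\<omega> in M. Y n \<omega> \<in> {x \<in> topspace E. f x \<in> \<Gamma>}) \<le> exp (- \<beta> * \<gamma> n)"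
      using L *(2) by blast
  qed (fact rate)
qed

section \<open>The path space\<close>

lemma topspace_path_top [simp]: "topspace (path_top T) = path_space T"
  by (simp add: path_top_def path_space_def)

lemma metric_space_path: "Metric_space (path_space T) (mdist (path_metric T))"
  by (simp add: path_space_def)

lemma path_top_eq: "path_top T = Metric_space.mtopology (path_space T) (mdist (path_metric T))"
  by (simp add: path_top_def path_space_def mtopology_of_def)

lemma metrizable_path_top: "metrizable_space (path_top T)"
  unfolding path_top_eq by (rule Metric_space.metrizable_space_mtopology[OF metric_space_path])

lemma path_space_iff: "f \<in> path_space T \<longleftrightarrow> continuous_on {0..T} f \<and> f \<in> extensional {0..T}"
proof -
  have "compactin (top_of_set {0..T}) (topspace (top_of_set {0..T}))"
    by (simp add: compactin_subtopology)
  from compactin_mspace_cfunspace[OF this, of euclidean_metric]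
  have "path_space T = {f. f \<in> extensional {0..T} \<and> continuous_on {0..T} f}"
    by (simp add: path_space_def path_metric_def conj_commute)
  then show ?thesis by auto
qed

lemma restrict_in_path_space: "continuous_on {0..T} f \<Longrightarrow> (\<lambda>t\<in>{0..T}. f t) \<in> path_space T"
  unfolding path_space_iff by (auto intro: continuous_on_eq)

lemma path_mdist_le_iff:
  assumes "0 \<le> T" "f \<in> path_space T" "g \<in> path_space T"
  shows "mdist (path_metric T) f g \<le> r \<longleftrightarrow> (\<forall>t\<in>{0..T}. dist (f t) (g t) \<le> r)"
  using assms cfunspace_mdist_le[of f "top_of_set {0..T}" euclidean_metric g r]
  by (simp add: path_space_def path_metric_def)

lemma dist_le_path_mdist:
  assumes "f \<in> path_space T" "g \<in> path_space T" "t \<in> {0..T}"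
  shows "dist (f t) (g t) \<le> mdist (path_metric T) f g"
  using path_mdist_le_iff[of T f g "mdist (path_metric T) f g"] assms by auto

lemma path_space_bounded:
  fixes f :: "real \<Rightarrow> 'a::real_normed_vector"
  assumes "f \<in> path_space T"
  obtains R where "0 \<le> R" "\<And>t. t \<in> {0..T} \<Longrightarrow> norm (f t) \<le> R"
proof -
  have "compact (f ` {0..T})"
    using assms by (intro compact_continuous_image) (auto simp: path_space_iff)
  then obtain R where "R > 0" "\<forall>x\<in>f ` {0..T}. norm x \<le> R"
    using compact_imp_bounded bounded_pos by blast
  then show ?thesis by (intro that[of R]) auto
qed

text \<open>
  Balls of radius \<open>1 / (k + 1)\<close> around a countable \<open>1 / (k + 1)\<close>-net, for all \<open>k\<close>, form a base.
\<close>

lemma (in Metric_space) second_countable_mtopology: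
  assumes "\<And>\<epsilon>. \<epsilon> > 0 \<Longrightarrow> \<exists>C. countable C \<and> C \<subseteq> M \<and> (\<forall>x\<in>M. \<exists>c\<in>C. d c x < \<epsilon>)"
  shows "second_countable mtopology"
proof -
  have "\<forall>k. \<exists>C. countable C \<and> C \<subseteq> M \<and> (\<forall>x\<in>M. \<exists>c\<in>C. d c x < 1 / real (Suc k))"
    using assms by simp
  then obtain C where C: "\<And>k. countable (C k)" "\<And>k. C k \<subseteq> M"
      "\<And>k x. x \<in> M \<Longrightarrow> \<exists>c\<in>C k. d c x < 1 / real (Suc k)"
    by metis
  define B where "B = (\<Union>k. (\<lambda>c. mball c (1 / real (Suc k))) ` C k)"
  show ?thesis
    unfolding second_countable_def
  proof (intro exI[of _ B] conjI ballI allI impI)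
    show "countable B" unfolding B_def by (intro countable_UN countable_image C) auto
    show "openin mtopology V" if "V \<in> B" for V using that by (auto simp: B_def)
    fix U x assume Ux: "openin mtopology U \<and> x \<in> U"
    then obtain r where r: "r > 0" "mball x r \<subseteq> U" and x: "x \<in> M"
      unfolding openin_mtopology by blast
    obtain k where k: "1 / real (Suc k) < r / 2"
      using reals_Archimedean[of "r / 2"] r(1) by (auto simp: inverse_eq_divide)
    obtain c where c: "c \<in> C k" "d c x < 1 / real (Suc k)" using C(3)[OF x] by blast
    have "c \<in> M" using C(2) c(1) by blast
    have "mball c (1 / real (Suc k)) \<subseteq> mball x r"
    proof
      fix y assume "y \<in> mball c (1 / real (Suc k))"
      then have y: "y \<in> M" "d c y < 1 / real (Suc k)" by auto
      have "d x y \<le> d x c + d c y" using x \<open>c \<in> M\<close> y(1) by (rule triangle)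
      also have "\<dots> < r" using c(2) y(2) k commute[of x c] by simp
      finally show "y \<in> mball x r" using x y by simp
    qed
    moreover have "x \<in> mball c (1 / real (Suc k))" using x \<open>c \<in> M\<close> c(2) by simp
    ultimately show "\<exists>V\<in>B. x \<in> V \<and> V \<subseteq> U"
      using c(1) r(2) by (intro bexI[of _ "mball c (1 / real (Suc k))"]) (auto simp: B_def)
  qed
qed

text \<open>
  Paths are coded by finite lists over a countable dense set: cut \<open>[0,T]\<close> into intervals of length
  \<open>1 / (N + 1)\<close> and record one value per interval that is \<open>\<epsilon> / 3\<close>-close to the path throughout the interval.
  Uniform continuity gives every path a code, two paths with the same code are \<open>2 \<epsilon> / 3\<close>-close, and there
  are countably many codes; one path for each code forms a countable \<open>\<epsilon>\<close>-net.
\<close>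

lemma second_countable_path_top:
  assumes "0 \<le> T"
  shows "second_countable (path_top T :: (real \<Rightarrow> 'a::{metric_space, second_countable_topology}) topology)"
  unfolding path_top_eq
proof (rule Metric_space.second_countable_mtopology[OF metric_space_path])
  fix \<epsilon> :: real assume "\<epsilon> > 0"
  obtain D :: "'a set" where D: "countable D" "\<And>X. open X \<Longrightarrow> X \<noteq> {} \<Longrightarrow> \<exists>d\<in>D. d \<in> X"
    by (rule countable_dense_setE) blast
  have D_dense: "\<exists>d\<in>D. dist x d < e" if "e > 0" for x e
    using D(2)[of "ball x e"] that by auto
  define code where "code = (\<lambda>(N, ds) (f :: real \<Rightarrow> 'a). f \<in> path_space T \<and>
    (\<forall>t\<in>{0..T}. dist (f t) (ds ! nat \<lfloor>t * real (Suc N)\<rfloor>) < \<epsilon> / 3))"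
  define C where "C = (\<lambda>c. SOME f. code c f) ` {c \<in> UNIV \<times> lists D. \<exists>f. code c f}"
  have C_countable: "countable C"
    unfolding C_def
    by (intro countable_image countable_Collect countable_SIGMA countable_lists D) auto
  have some: "code c (SOME f. code c f)" if "code c f" for c f
    using that by (rule someI[of "code c"])
  then have C_subset: "C \<subseteq> path_space T"
    unfolding C_def by (fastforce simp: code_def)
  have "\<exists>c\<in>C. mdist (path_metric T) c f < \<epsilon>" if f: "f \<in> path_space T" for f
  proof -
    have "uniformly_continuous_on {0..T} f"
      using f by (intro compact_uniformly_continuous) (auto simp: path_space_iff)
    then obtain \<delta> where \<delta>: "\<delta> > 0" "\<And>s t. s \<in> {0..T} \<Longrightarrow> t \<in> {0..T} \<Longrightarrow> dist s t < \<delta> \<Longrightarrow> dist (f s) (f t) < \<epsilon> / 6"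
      using \<open>\<epsilon> > 0\<close> unfolding uniformly_continuous_on_def by (metis divide_pos_pos zero_less_numeral)
    obtain N where N: "1 / real (Suc N) < \<delta>"
      using reals_Archimedean[OF \<delta>(1)] by (auto simp: inverse_eq_divide)
    have "\<forall>j. \<exists>d\<in>D. dist (f (real j / real (Suc N))) d < \<epsilon> / 6"
      using \<open>\<epsilon> > 0\<close> by (intro allI D_dense) simp
    then obtain q where q: "\<And>j. q j \<in> D" "\<And>j. dist (f (real j / real (Suc N))) (q j) < \<epsilon> / 6"
      by metis
    \<comment> \<open>The value at the left end of each interval, approximated within \<open>\<epsilon> / 6\<close>; the last interval may start at \<open>T\<close>.\<close>
    define ds where "ds = map q [0..<Suc (nat \<lfloor>T * real (Suc N)\<rfloor>)]"
    have "dist (f t) (ds ! nat \<lfloor>t * real (Suc N)\<rfloor>) < \<epsilon> / 3" if t: "t \<in> {0..T}" for t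
    proof -
      define j where "j = nat \<lfloor>t * real (Suc N)\<rfloor>"
      have t0: "0 \<le> t * real (Suc N)" using t by simp
      have "j \<le> nat \<lfloor>T * real (Suc N)\<rfloor>"
        unfolding j_def using t by (intro nat_mono floor_mono mult_right_mono) auto
      then have "j < Suc (nat \<lfloor>T * real (Suc N)\<rfloor>)" by simp
      then have ds: "ds ! j = q j" unfolding ds_def by (simp del: upt_Suc)
      have j: "real j \<le> t * real (Suc N)" "t * real (Suc N) < real j + 1"
        using t0 unfolding j_def by linarith+
      have j1: "real j / real (Suc N) \<le> t"
        using j(1) by (simp add: divide_le_eq del: of_nat_Suc)
      have j2: "t < real j / real (Suc N) + 1 / real (Suc N)"
        using j(2) by (simp add: field_simps del: of_nat_Suc)
      have "dist (f t) (f (real j / real (Suc N))) < \<epsilon> / 6"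
        using j1 j2 t N by (intro \<delta>(2)) (auto simp: dist_real_def simp del: of_nat_Suc)
      then have "dist (f t) (q j) < \<epsilon> / 3"
        using dist_triangle[of "f t" "q j" "f (real j / real (Suc N))"] q(2)[of j] by linarith
      then show ?thesis unfolding j_def[symmetric] ds .
    qed
    then have code: "code (N, ds) f" using f by (simp add: code_def)
    define g where "g = (SOME f. code (N, ds) f)"
    have g: "code (N, ds) g" unfolding g_def using code by (rule some)
    have "ds \<in> lists D" using q(1) by (auto simp: ds_def)
    then have "g \<in> C" unfolding C_def g_def using code by blast
    have "mdist (path_metric T) g f \<le> 2 * \<epsilon> / 3"
    proof (subst path_mdist_le_iff)
      show "\<forall>t\<in>{0..T}. dist (g t) (f t) \<le> 2 * \<epsilon> / 3"
      proof
        fix t assume "t \<in> {0..T}"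
        then have "dist (g t) (ds ! nat \<lfloor>t * real (Suc N)\<rfloor>) < \<epsilon> / 3"
          "dist (f t) (ds ! nat \<lfloor>t * real (Suc N)\<rfloor>) < \<epsilon> / 3"
          using g code by (auto simp: code_def)
        then show "dist (g t) (f t) \<le> 2 * \<epsilon> / 3"
          using dist_triangle2[of "g t" "f t" "ds ! nat \<lfloor>t * real (Suc N)\<rfloor>"] by linarith
      qed
    qed (use f g assms in \<open>auto simp: code_def\<close>)
    then show ?thesis using \<open>g \<in> C\<close> \<open>\<epsilon> > 0\<close> by (intro bexI[of _ g]) auto
  qed
  then show "\<exists>C. countable C \<and> C \<subseteq> (path_space T :: (real \<Rightarrow> 'a) set) \<and>
      (\<forall>f\<in>path_space T. \<exists>c\<in>C. mdist (path_metric T) c f < \<epsilon>)"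
    using C_countable C_subset by (intro exI[of _ C]) simp
qed

lemma path_affine_in_path_space:
  assumes "x \<in> path_space T" "b \<in> path_space T"
  shows "path_affine T a x b \<in> path_space T"
  unfolding path_affine_def using assms
  by (intro restrict_in_path_space continuous_intros) (auto simp: path_space_iff)

lemma continuous_map_path_affine:
  fixes T :: real
  assumes "0 \<le> T"
  shows "continuous_map (prod_topology (prod_topology half_line (path_top T)) (path_top T))
     (path_top T :: (real \<Rightarrow> 'a::real_normed_vector) topology) (\<lambda>((a, b), x). path_affine T a x b)"
proof -
  let ?f = "\<lambda>((a, b), x). path_affine T a x b :: real \<Rightarrow> 'a"
  interpret P: Metric_space "path_space T :: (real \<Rightarrow> 'a) set" "mdist (path_metric T)"
    by (rule metric_space_path)
  show ?thesis
    unfolding path_top_eq P.continuous_map_to_metric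
  proof (intro ballI allI impI)
    fix p :: "(real \<times> (real \<Rightarrow> 'a)) \<times> (real \<Rightarrow> 'a)" and \<epsilon> :: real
    assume p: "p \<in> topspace (prod_topology (prod_topology half_line P.mtopology) P.mtopology)"
      and "\<epsilon> > 0"
    obtain a b x where p_eq: "p = ((a, b), x)" by (metis prod.exhaust)
    have a: "a \<ge> 0" and b: "b \<in> path_space T" and x: "x \<in> path_space T"
      using p by (auto simp: p_eq)
    obtain R where R: "0 \<le> R" "\<And>t. t \<in> {0..T} \<Longrightarrow> norm (x t) \<le> R"
      using path_space_bounded[OF x] by metis
    define \<delta> where "\<delta> = min 1 (\<epsilon> / (2 * (a + R + 2)))"
    have \<delta>: "\<delta> > 0" "\<delta> \<le> 1" "(a + R + 2) * \<delta> \<le> \<epsilon> / 2"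
    proof -
      show "\<delta> > 0" "\<delta> \<le> 1" using \<open>\<epsilon> > 0\<close> a R(1) by (auto simp: \<delta>_def)
      have "(a + R + 2) * \<delta> \<le> (a + R + 2) * (\<epsilon> / (2 * (a + R + 2)))"
        using a R(1) by (intro mult_left_mono) (auto simp: \<delta>_def)
      also have "\<dots> = \<epsilon> / 2" using a R(1) by (simp add: field_simps)
      finally show "(a + R + 2) * \<delta> \<le> \<epsilon> / 2" .
    qed
    define U where "U = (({0..} \<inter> ball a \<delta>) \<times> P.mball b \<delta>) \<times> P.mball x \<delta>"
    have "openin half_line ({0..} \<inter> ball a \<delta>)"
      by (simp add: openin_open_Int)
    then have "openin (prod_topology (prod_topology half_line P.mtopology) P.mtopology) U"
      unfolding U_def by (simp add: openin_prod_Times_iff)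
    moreover have "p \<in> U" using a b x \<delta>(1) by (simp add: U_def p_eq)
    moreover have "?f q \<in>
        P.mball (?f p) \<epsilon>" if q: "q \<in> U" for q
    proof -
      obtain a' b' x' where q_eq: "q = ((a', b'), x')" by (metis prod.exhaust)
      have q': "0 \<le> a'" "\<bar>a' - a\<bar> < \<delta>" "b' \<in> path_space T" "x' \<in> path_space T"
        "mdist (path_metric T) b b' < \<delta>" "mdist (path_metric T) x x' < \<delta>"
        using q by (auto simp: U_def q_eq dist_real_def)
      have "dist (path_affine T a x b t) (path_affine T a' x' b' t) \<le> \<epsilon> / 2" if t: "t \<in> {0..T}" for t
      proof -
        have xt: "norm (x t - x' t) \<le> \<delta>" and bt: "norm (b t - b' t) \<le> \<delta>"
          using dist_le_path_mdist[OF x q'(4) t] dist_le_path_mdist[OF b q'(3) t] q'(5,6)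
          by (auto simp: dist_norm)
        have "path_affine T a x b t - path_affine T a' x' b' t =
            a' *\<^sub>R (x t - x' t) + (a - a') *\<^sub>R x t + (b t - b' t)"
          using t by (simp add: path_affine_def algebra_simps)
        then have "dist (path_affine T a x b t) (path_affine T a' x' b' t) \<le>
            norm (a' *\<^sub>R (x t - x' t)) + norm ((a - a') *\<^sub>R x t) + norm (b t - b' t)"
          unfolding dist_norm by (metis norm_triangle_ineq norm_triangle_mono order_refl)
        also have "\<dots> = a' * norm (x t - x' t) + \<bar>a' - a\<bar> * norm (x t) + norm (b t - b' t)"
          using q'(1) by (simp add: abs_minus_commute)
        also have "\<dots> \<le> (a + 1) * \<delta> + \<delta> * R + \<delta>"
          using xt bt R(2)[OF t] q'(1,2) \<delta>(1,2) by (intro add_mono mult_mono) auto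
        also have "\<dots> \<le> \<epsilon> / 2" using \<delta>(3) by (simp add: algebra_simps)
        finally show ?thesis .
      qed
      then have "mdist (path_metric T) (path_affine T a x b) (path_affine T a' x' b') \<le> \<epsilon> / 2"
        using assms x b q' by (subst path_mdist_le_iff) (auto intro: path_affine_in_path_space)
      then show ?thesis
        using \<open>\<epsilon> > 0\<close> x b q' by (auto simp: p_eq q_eq intro: path_affine_in_path_space)
    qed
    ultimately show "\<exists>U. openin (prod_topology (prod_topology half_line P.mtopology) P.mtopology) U \<and> p \<in> U \<and>
        (\<forall>q\<in>U. ?f q \<in>
          P.mball (?f p) \<epsilon>)"
      by blast
  qed
qed

lemma borel_of_euclidean: "borel_of euclidean = borel"
  by (simp add: borel_of_def borel_def)

text \<open>
  Joint continuity in path and time is what makes a continuous process jointly measurable, as needed for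
  Fubini's theorem.
\<close>

lemma continuous_map_path_eval:
  "continuous_map (prod_topology (path_top T) (top_of_set {0..T}))
     (euclidean :: 'a::metric_space topology) (\<lambda>(f, t). f t)"
proof -
  let ?f = "\<lambda>(f, t). f t :: 'a"
  interpret P: Metric_space "path_space T :: (real \<Rightarrow> 'a) set" "mdist (path_metric T)"
    by (rule metric_space_path)
  show ?thesis
    unfolding Met_TC.continuous_map_to_metric[unfolded mtopology_is_euclidean] path_top_eq
  proof (intro ballI allI impI)
    fix p :: "(real \<Rightarrow> 'a) \<times> real" and \<epsilon> :: real
    assume p: "p \<in> topspace (prod_topology P.mtopology (top_of_set {0..T}))" and "\<epsilon> > 0"
    obtain f t where p_eq: "p = (f, t)" by (cases p)
    have f: "f \<in> path_space T" and t: "t \<in> {0..T}" using p by (auto simp: p_eq)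
    then obtain \<delta> where \<delta>: "\<delta> > 0" "\<And>s. s \<in> {0..T} \<Longrightarrow> dist s t < \<delta> \<Longrightarrow> dist (f s) (f t) < \<epsilon> / 2"
      using \<open>\<epsilon> > 0\<close> unfolding path_space_iff continuous_on_iff by (metis half_gt_zero)
    define W where "W = P.mball f (\<epsilon> / 2) \<times> ({0..T} \<inter> ball t \<delta>)"
    have "openin (prod_topology P.mtopology (top_of_set {0..T})) W"
      unfolding W_def by (simp add: openin_prod_Times_iff openin_open_Int)
    moreover have "p \<in> W" using f t \<delta>(1) \<open>\<epsilon> > 0\<close> by (simp add: W_def p_eq)
    moreover have "?f q \<in> Met_TC.mball (?f p) \<epsilon>" if q: "q \<in> W" for q
    proof -
      obtain g s where q_eq: "q = (g, s)" by (cases q)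
      have g: "g \<in> path_space T" "mdist (path_metric T) f g < \<epsilon> / 2"
        and s: "s \<in> {0..T}" "dist s t < \<delta>"
        using q by (auto simp: W_def q_eq dist_commute)
      have "dist (f s) (g s) < \<epsilon> / 2"
        using dist_le_path_mdist[OF f g(1) s(1)] g(2) by simp
      moreover have "dist (f t) (g s) \<le> dist (f s) (f t) + dist (f s) (g s)"
        by (rule dist_triangle3)
      ultimately show ?thesis using \<delta>(2)[OF s] by (simp add: p_eq q_eq)
    qed
    ultimately show "\<exists>W. openin (prod_topology P.mtopology (top_of_set {0..T})) W \<and> p \<in> W \<and>
        (\<forall>q\<in>W. ?f q \<in> Met_TC.mball (?f p) \<epsilon>)"
      by blast
  qed
qed

section \<open>Reproducing kernel Hilbert spaces of Gaussian processes\<close>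

lemma measurable_process_on_product:
  fixes U :: "'u \<Rightarrow> real \<Rightarrow> real"
  assumes U: "U \<in> N \<rightarrow>\<^sub>M borel_of (path_top T)" and T: "0 \<le> T"
    and \<nu>: "sets \<nu> = sets (restrict_space borel {0..T})"
  shows "(\<lambda>(\<omega>, t). U \<omega> t) \<in> borel_measurable (N \<Otimes>\<^sub>M \<nu>)"
proof -
  have "(\<lambda>t. t) \<in> \<nu> \<rightarrow>\<^sub>M borel_of (top_of_set {0..T})"
  proof (rule measurable_borel_of)
    show "t \<in> topspace (top_of_set {0..T})" if "t \<in> space \<nu>" for t
      using that sets_eq_imp_space_eq[OF \<nu>] by (simp add: space_restrict_space)
    fix S assume "openin (top_of_set {0..T}) S"
    then obtain V where "open V" "S = {0..T} \<inter> V" by (auto simp: openin_open)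
    then show "(\<lambda>t. t) -` S \<inter> space \<nu> \<in> sets \<nu>"
      using sets_eq_imp_space_eq[OF \<nu>] unfolding \<nu>
      by (auto simp: sets_restrict_space space_restrict_space)
  qed
  from measurable_compose[OF measurable_snd this] measurable_compose[OF measurable_fst U]
  have "(\<lambda>p. (U (fst p), snd p)) \<in>
      N \<Otimes>\<^sub>M \<nu> \<rightarrow>\<^sub>M borel_of (prod_topology (path_top T) (top_of_set {0..T}))"
    by (intro measurable_pair_borel_of second_countable_path_top[OF T]
        second_countable_subtopology second_countable_euclidean)
  from measurable_compose[OF this continuous_map_measurable_borel_of[OF continuous_map_path_eval]]
  show ?thesis
    by (simp add: borel_of_euclidean case_prod_beta')
qed

lemma measurable_process_at:
  fixes U :: "'u \<Rightarrow> real \<Rightarrow> real"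
  assumes U: "U \<in> N \<rightarrow>\<^sub>M borel_of (path_top T)" and t: "t \<in> {0..T}"
  shows "(\<lambda>\<omega>. U \<omega> t) \<in> borel_measurable N"
proof -
  have "(\<lambda>(\<omega>, t). U \<omega> t) \<in> borel_measurable (N \<Otimes>\<^sub>M restrict_space borel {0..T})"
    using U t by (intro measurable_process_on_product) auto
  from measurable_compose[OF measurable_Pair2' this, of t] show ?thesis
    using t by (simp add: space_restrict_space)
qed

lemma nn_integral_square_normal:
  assumes \<sigma>: "\<sigma> > 0" and Y [measurable]: "Y \<in> borel_measurable N"
    and distr: "distr N borel Y = density lborel (\<lambda>x. ennreal (normal_density 0 \<sigma> x))"
  shows "(\<integral>\<^sup>+\<omega>. ennreal ((Y \<omega>)\<^sup>2) \<partial>N) = ennreal (\<sigma>\<^sup>2)"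
proof -
  have m: "has_bochner_integral lborel (\<lambda>x. normal_density 0 \<sigma> x * x\<^sup>2) (\<sigma>\<^sup>2)"
    using normal_moment_even[OF \<sigma>, of 0 1] by (simp add: fact_2 power2_eq_square)
  have "(\<integral>\<^sup>+\<omega>. ennreal ((Y \<omega>)\<^sup>2) \<partial>N) = (\<integral>\<^sup>+x. ennreal (x\<^sup>2) \<partial>distr N borel Y)"
    by (simp add: nn_integral_distr)
  also have "\<dots> = (\<integral>\<^sup>+x. ennreal (normal_density 0 \<sigma> x * x\<^sup>2) \<partial>lborel)"
    unfolding distr by (subst nn_integral_density) (auto simp: ennreal_mult')
  also have "\<dots> = ennreal (\<sigma>\<^sup>2)"
    using m by (subst nn_integral_eq_integral) (auto simp: has_bochner_integral_iff)
  finally show ?thesis .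
qed

text \<open>
  The density of a normal law is at most \<open>1 / (2 \<sigma>)\<close>, so a very spread out variable cannot stay in \<open>[-K, K]\<close>
  with probability \<open>1/2\<close>.
\<close>

lemma normal_std_deviation_le:
  assumes N: "prob_space N" and \<sigma>: "\<sigma> > 0" and Y [measurable]: "Y \<in> borel_measurable N"
    and distr: "distr N borel Y = density lborel (\<lambda>x. ennreal (normal_density 0 \<sigma> x))"
    and K: "K \<ge> 0" "\<P>(\<omega> in N. \<bar>Y \<omega>\<bar> \<le> K) \<ge> 1 / 2"
  shows "\<sigma> \<le> 2 * K"
proof -
  interpret prob_space N by fact
  have le: "normal_density 0 \<sigma> x \<le> 1 / (2 * \<sigma>)" for x
  proof -
    have "(2 * \<sigma>)\<^sup>2 \<le> 2 * pi * \<sigma>\<^sup>2"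
      using mult_right_mono[OF pi_ge_two, of "2 * \<sigma>\<^sup>2"] by (simp add: power_mult_distrib)
    then have "2 * \<sigma> \<le> sqrt (2 * pi * \<sigma>\<^sup>2)" by (rule real_le_rsqrt)
    then have "1 / sqrt (2 * pi * \<sigma>\<^sup>2) \<le> 1 / (2 * \<sigma>)"
      using \<sigma> by (intro divide_left_mono) auto
    moreover have "exp (- (x - 0)\<^sup>2 / (2 * \<sigma>\<^sup>2)) \<le> 1"
      by simp
    ultimately have "1 / sqrt (2 * pi * \<sigma>\<^sup>2) * exp (- (x - 0)\<^sup>2 / (2 * \<sigma>\<^sup>2)) \<le> 1 / (2 * \<sigma>) * 1"
      using \<sigma> by (intro mult_mono) auto
    then show ?thesis by (simp add: normal_density_def)
  qed
  have "ennreal \<P>(\<omega> in N. \<bar>Y \<omega>\<bar> \<le> K) = emeasure (distr N borel Y) {-K..K}"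
    by (subst emeasure_distr) (auto simp: emeasure_eq_measure intro!: arg_cong[where f=prob])
  also have "\<dots> = (\<integral>\<^sup>+x. ennreal (normal_density 0 \<sigma> x) * indicator {-K..K} x \<partial>lborel)"
    unfolding distr by (subst emeasure_density) auto
  also have "\<dots> \<le> (\<integral>\<^sup>+x. ennreal (1 / (2 * \<sigma>)) * indicator {-K..K} x \<partial>lborel)"
    using le by (intro nn_integral_mono mult_right_mono ennreal_leI) auto
  also have "\<dots> = ennreal (1 / (2 * \<sigma>)) * ennreal (2 * K)"
    using K(1) by (subst nn_integral_cmult_indicator) auto
  also have "\<dots> = ennreal (K / \<sigma>)"
    using \<sigma> K(1) by (subst ennreal_mult'[symmetric]) auto
  finally have "\<P>(\<omega> in N. \<bar>Y \<omega>\<bar> \<le> K) \<le> K / \<sigma>"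
    using \<sigma> K(1) by (subst (asm) ennreal_le_iff) auto
  with K(2) have "1 / 2 \<le> K / \<sigma>" by linarith
  then show ?thesis using \<sigma> by (simp add: field_simps)
qed

text \<open>
  A continuous path is bounded, so for some \<open>n\<close> all values stay in \<open>[-n, n]\<close> with probability above \<open>1/2\<close>,
  for all times at once.  For Gaussian variables this bounds the variances.
\<close>

lemma gaussian_process_second_moment_bounded:
  fixes U :: "'u \<Rightarrow> real \<Rightarrow> real"
  assumes G: "continuous_centered_gaussian_process T N U" and T: "0 \<le> T"
  obtains v where "0 \<le> v" "\<And>t. t \<in> {0..T} \<Longrightarrow> (\<integral>\<^sup>+\<omega>. ennreal ((U \<omega> t)\<^sup>2) \<partial>N) \<le> ennreal v"
proof -
  have N: "prob_space N" and U: "U \<in> N \<rightarrow>\<^sub>M borel_of (path_top T)"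
    using G by (auto simp: continuous_centered_gaussian_process_def)
  interpret prob_space N by fact
  interpret P: Metric_space "path_space T :: (real \<Rightarrow> real) set" "mdist (path_metric T)"
    by (rule metric_space_path)
  define z :: "real \<Rightarrow> real" where "z = (\<lambda>t\<in>{0..T}. 0)"
  have z: "z \<in> path_space T" unfolding z_def by (rule restrict_in_path_space) simp
  have U_space: "U \<omega> \<in> path_space T" if "\<omega> \<in> space N" for \<omega>
    using measurable_space[OF U that] by simp
  define A where "A n = U -` P.mcball z (real n) \<inter> space N" for n :: nat
  have "A n \<in> sets N" for n
    unfolding A_def
    by (intro measurable_sets[OF U] closed_in_sets_borel_of) (simp add: path_top_eq P.closedin_mcball)
  moreover have "incseq A"
    by (rule incseq_SucI) (auto simp: A_def)
  ultimately have "(\<lambda>n. prob (A n)) \<longlonglongrightarrow> prob (\<Union>n. A n)"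
    by (intro finite_Lim_measure_incseq) auto
  moreover have "(\<Union>n. A n) = space N"
  proof
    show "space N \<subseteq> (\<Union>n. A n)"
    proof
      fix \<omega> assume \<omega>: "\<omega> \<in> space N"
      obtain n where "mdist (path_metric T) z (U \<omega>) \<le> real n" using real_arch_simple by blast
      then show "\<omega> \<in> (\<Union>n. A n)" using \<omega> z U_space[OF \<omega>] by (auto simp: A_def)
    qed
  qed (auto simp: A_def)
  ultimately have "(\<lambda>n. prob (A n)) \<longlonglongrightarrow> 1" using prob_space by simp
  then have "\<forall>\<^sub>F n in sequentially. 1 / 2 < prob (A n)"
    by (rule order_tendstoD) simp
  then obtain n where n: "1 / 2 < prob (A n)"
    by (auto simp: eventually_sequentially)
  have "(\<integral>\<^sup>+\<omega>. ennreal ((U \<omega> t)\<^sup>2) \<partial>N) \<le> ennreal ((2 * real n)\<^sup>2)" if t: "t \<in> {0..T}" for t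
  proof -
    have "centered_gaussian N (\<lambda>\<omega>. \<Sum>s\<in>{t}. 1 \<bullet> U \<omega> s)"
      using G t unfolding continuous_centered_gaussian_process_def
      by (elim conjE allE[of _ "{t}"] allE[of _ "\<lambda>_. 1"]) auto
    then have cg: "centered_gaussian N (\<lambda>\<omega>. U \<omega> t)" by simp
    then have [measurable]: "(\<lambda>\<omega>. U \<omega> t) \<in> borel_measurable N"
      by (simp add: centered_gaussian_def)
    from cg consider "distr N borel (\<lambda>\<omega>. U \<omega> t) = return borel 0"
      | \<sigma> where "\<sigma> > 0" "distr N borel (\<lambda>\<omega>. U \<omega> t) = density lborel (\<lambda>x. ennreal (normal_density 0 \<sigma> x))"
      by (auto simp: centered_gaussian_def)
    then show ?thesis
    proof cases
      case 1
      have "(\<integral>\<^sup>+\<omega>. ennreal ((U \<omega> t)\<^sup>2) \<partial>N) = (\<integral>\<^sup>+x. ennreal (x\<^sup>2) \<partial>distr N borel (\<lambda>\<omega>. U \<omega> t))"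
        by (simp add: nn_integral_distr)
      also have "\<dots> = 0" unfolding 1 by (subst nn_integral_return) auto
      finally show ?thesis by simp
    next
      case 2
      have "A n \<subseteq> {\<omega> \<in> space N. \<bar>U \<omega> t\<bar> \<le> real n}"
      proof
        fix \<omega> assume \<omega>: "\<omega> \<in> A n"
        then have "U \<omega> \<in> path_space T" "mdist (path_metric T) z (U \<omega>) \<le> real n" by (auto simp: A_def)
        with dist_le_path_mdist[OF z this(1) t] have "dist (z t) (U \<omega> t) \<le> real n" by linarith
        then show "\<omega> \<in> {\<omega> \<in> space N. \<bar>U \<omega> t\<bar> \<le> real n}"
          using \<omega> t by (simp add: A_def z_def dist_real_def)
      qed
      then have "prob (A n) \<le> \<P>(\<omega> in N. \<bar>U \<omega> t\<bar> \<le> real n)"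
        by (intro finite_measure_mono) auto
      then have "\<sigma> \<le> 2 * real n"
        using n by (intro normal_std_deviation_le[OF N 2(1) _ 2(2)]) auto
      then show ?thesis
        using 2(1) power_mono[of \<sigma> "2 * real n" 2]
        by (subst nn_integral_square_normal[OF 2(1) _ 2(2)]) (auto intro!: ennreal_leI)
    qed
  qed
  then show ?thesis by (intro that[of "(2 * real n)\<^sup>2"]) auto
qed

lemma abs_mult_le_sum_squares:
  fixes x y :: real
  shows "\<bar>x * y\<bar> \<le> x\<^sup>2 + y\<^sup>2"
proof -
  have "2 * \<bar>x\<bar> * \<bar>y\<bar> \<le> x\<^sup>2 + y\<^sup>2"
    using sum_squares_bound[of "\<bar>x\<bar>" "\<bar>y\<bar>"] by simp
  moreover have "0 \<le> \<bar>x\<bar> * \<bar>y\<bar>" by simp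
  ultimately show ?thesis unfolding abs_mult by linarith
qed

lemma integrable_mult_of_squares:
  fixes f g :: "'u \<Rightarrow> real"
  assumes [measurable]: "f \<in> borel_measurable N" "g \<in> borel_measurable N"
    and sq: "integrable N (\<lambda>x. (f x)\<^sup>2)" "integrable N (\<lambda>x. (g x)\<^sup>2)"
  shows "integrable N (\<lambda>x. f x * g x)"
proof (rule Bochner_Integration.integrable_bound)
  show "integrable N (\<lambda>x. (f x)\<^sup>2 + (g x)\<^sup>2)" using sq by simp
  show "AE x in N. norm (f x * g x) \<le> norm ((f x)\<^sup>2 + (g x)\<^sup>2)"
  proof (rule AE_I2)
    fix x
    show "norm (f x * g x) \<le> norm ((f x)\<^sup>2 + (g x)\<^sup>2)"
      using abs_mult_le_sum_squares[of "f x" "g x"] by simp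
  qed
qed measurable

lemma gaussian_process_square_integrable:
  fixes U :: "'u \<Rightarrow> real \<Rightarrow> real"
  assumes G: "continuous_centered_gaussian_process T N U" and t: "t \<in> {0..T}"
  shows "integrable N (\<lambda>\<omega>. (U \<omega> t)\<^sup>2)"
proof -
  have U: "U \<in> N \<rightarrow>\<^sub>M borel_of (path_top T)"
    using G by (auto simp: continuous_centered_gaussian_process_def)
  note [measurable] = measurable_process_at[OF U t]
  have "0 \<le> T" using t by simp
  then obtain v where "(\<integral>\<^sup>+\<omega>. ennreal ((U \<omega> t)\<^sup>2) \<partial>N) \<le> ennreal v"
    using gaussian_process_second_moment_bounded[OF G] t by metis
  then have "(\<integral>\<^sup>+\<omega>. ennreal ((U \<omega> t)\<^sup>2) \<partial>N) < \<infinity>"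
    using ennreal_less_top le_less_trans by (metis infinity_ennreal_def)
  then show ?thesis by (intro integrableI_nonneg) auto
qed

text \<open>
  Exchanging the integrals over \<open>[0,T]\<close> and over the probability space reduces orthogonality to integrals of
  \<open>U\<close> to orthogonality to the values \<open>U(t)\<close>; bounded second moments make the exchange legitimate.
\<close>

lemma path_integral_orthogonal:
  fixes U :: "'u \<Rightarrow> real \<Rightarrow> real"
  assumes G: "continuous_centered_gaussian_process T N U" and T: "0 \<le> T"
    and D [measurable]: "D \<in> borel_measurable N" and D2: "integrable N (\<lambda>\<omega>. (D \<omega>)\<^sup>2)"
    and orth: "\<And>t. t \<in> {0..T} \<Longrightarrow> (\<integral>\<omega>. U \<omega> t * D \<omega> \<partial>N) = 0"
    and V: "V \<in> path_integrals T N U"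
  shows "integrable N (\<lambda>\<omega>. V \<omega> * D \<omega>)" and "(\<integral>\<omega>. V \<omega> * D \<omega> \<partial>N) = 0"
proof -
  have N: "prob_space N" and U: "U \<in> N \<rightarrow>\<^sub>M borel_of (path_top T)"
    using G by (auto simp: continuous_centered_gaussian_process_def)
  interpret prob_space N by fact
  obtain v where v: "0 \<le> v" "\<And>t. t \<in> {0..T} \<Longrightarrow> (\<integral>\<^sup>+\<omega>. ennreal ((U \<omega> t)\<^sup>2) \<partial>N) \<le> ennreal v"
    using gaussian_process_second_moment_bounded[OF G T] by metis
  have *: "integrable N (\<lambda>\<omega>. (\<integral>t. U \<omega> t \<partial>\<nu>) * D \<omega>) \<and> (\<integral>\<omega>. (\<integral>t. U \<omega> t \<partial>\<nu>) * D \<omega> \<partial>N) = 0"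
    if fin: "finite_measure \<nu>" and \<nu>: "sets \<nu> = sets (restrict_space borel {0..T})" for \<nu>
  proof -
    interpret \<nu>: finite_measure \<nu> by fact
    interpret pair_sigma_finite N \<nu> ..
    have space_\<nu>: "space \<nu> = {0..T}"
      using sets_eq_imp_space_eq[OF \<nu>] by (simp add: space_restrict_space)
    have U_prod [measurable]: "(\<lambda>(\<omega>, t). U \<omega> t) \<in> borel_measurable (N \<Otimes>\<^sub>M \<nu>)"
      by (rule measurable_process_on_product[OF U T \<nu>])
    have U_prod' [measurable]: "(\<lambda>p. U (fst p) (snd p)) \<in> borel_measurable (N \<Otimes>\<^sub>M \<nu>)"
      using U_prod by (simp add: case_prod_beta')
    define c where "c = (\<integral>\<omega>. (D \<omega>)\<^sup>2 \<partial>N)"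
    have c: "(\<integral>\<^sup>+\<omega>. ennreal ((D \<omega>)\<^sup>2) \<partial>N) = ennreal c" "0 \<le> c"
      unfolding c_def using nn_integral_eq_integral[OF D2] by auto
    \<comment> \<open>A bound uniform in \<open>t\<close>, so that it is integrable against the finite measure \<open>\<nu>\<close>.\<close>
    have inner: "(\<integral>\<^sup>+\<omega>. ennreal (norm (U \<omega> t * D \<omega>)) \<partial>N) \<le> ennreal (v + c)" if t: "t \<in> space \<nu>" for t
    proof -
      have t': "t \<in> {0..T}" using t space_\<nu> by simp
      note [measurable] = measurable_process_at[OF U t']
      have "(\<integral>\<^sup>+\<omega>. ennreal (norm (U \<omega> t * D \<omega>)) \<partial>N) \<le> (\<integral>\<^sup>+\<omega>. ennreal ((U \<omega> t)\<^sup>2) + ennreal ((D \<omega>)\<^sup>2) \<partial>N)"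
      proof (rule nn_integral_mono)
        fix \<omega>
        have "norm (U \<omega> t * D \<omega>) \<le> (U \<omega> t)\<^sup>2 + (D \<omega>)\<^sup>2"
          using abs_mult_le_sum_squares by simp
        then show "ennreal (norm (U \<omega> t * D \<omega>)) \<le> ennreal ((U \<omega> t)\<^sup>2) + ennreal ((D \<omega>)\<^sup>2)"
          by (simp add: ennreal_leI ennreal_plus[symmetric] del: ennreal_plus)
      qed
      also have "\<dots> = (\<integral>\<^sup>+\<omega>. ennreal ((U \<omega> t)\<^sup>2) \<partial>N) + ennreal c"
        unfolding c(1)[symmetric] by (rule nn_integral_add) auto
      also have "\<dots> \<le> ennreal (v + c)"
        using v(2)[OF t'] v(1) c(2) by (simp add: add_right_mono)
      finally show ?thesis .
    qed
    have int: "integrable (N \<Otimes>\<^sub>M \<nu>) (\<lambda>(\<omega>, t). U \<omega> t * D \<omega>)"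
    proof (rule integrableI_bounded)
      show "(\<lambda>(\<omega>, t). U \<omega> t * D \<omega>) \<in> borel_measurable (N \<Otimes>\<^sub>M \<nu>)"
        unfolding case_prod_beta' by measurable
      then have "(\<integral>\<^sup>+p. ennreal (norm (case p of (\<omega>, t) \<Rightarrow> U \<omega> t * D \<omega>)) \<partial>(N \<Otimes>\<^sub>M \<nu>)) =
          (\<integral>\<^sup>+t. \<integral>\<^sup>+\<omega>. ennreal (norm (U \<omega> t * D \<omega>)) \<partial>N \<partial>\<nu>)"
        by (subst nn_integral_snd[symmetric]) auto
      also have "\<dots> \<le> (\<integral>\<^sup>+t. ennreal (v + c) \<partial>\<nu>)"
        by (rule nn_integral_mono) (rule inner)
      also have "\<dots> < \<infinity>"
        by (simp add: ennreal_mult_eq_top_iff less_top[symmetric])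
      finally show "(\<integral>\<^sup>+p. ennreal (norm (case p of (\<omega>, t) \<Rightarrow> U \<omega> t * D \<omega>)) \<partial>(N \<Otimes>\<^sub>M \<nu>)) < \<infinity>" .
    qed
    have "(\<integral>\<omega>. (\<integral>t. U \<omega> t * D \<omega> \<partial>\<nu>) \<partial>N) = (\<integral>t. (\<integral>\<omega>. U \<omega> t * D \<omega> \<partial>N) \<partial>\<nu>)"
      by (rule Fubini_integral[OF int, symmetric])
    also have "\<dots> = (\<integral>t. 0 \<partial>\<nu>)"
      using orth space_\<nu> by (intro Bochner_Integration.integral_cong) auto
    finally show ?thesis
      using integrable_fst[OF int] by simp
  qed
  obtain \<nu>1 \<nu>2 where V_eq: "V = (\<lambda>\<omega>. (\<integral>t. U \<omega> t \<partial>\<nu>1) - (\<integral>t. U \<omega> t \<partial>\<nu>2))"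
    and \<nu>: "finite_measure \<nu>1" "sets \<nu>1 = sets (restrict_space borel {0..T})"
      "finite_measure \<nu>2" "sets \<nu>2 = sets (restrict_space borel {0..T})"
    using V by (auto simp: path_integrals_def)
  show "integrable N (\<lambda>\<omega>. V \<omega> * D \<omega>)" "(\<integral>\<omega>. V \<omega> * D \<omega> \<partial>N) = 0"
    using *[OF \<nu>(1,2)] *[OF \<nu>(3,4)] by (simp_all add: V_eq left_diff_distrib)
qed

lemma measurable_path_integral:
  fixes U :: "'u \<Rightarrow> real \<Rightarrow> real"
  assumes G: "continuous_centered_gaussian_process T N U" and T: "0 \<le> T"
    and V: "V \<in> path_integrals T N U"
  shows "V \<in> borel_measurable N"
proof -
  have U: "U \<in> N \<rightarrow>\<^sub>M borel_of (path_top T)"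
    using G by (auto simp: continuous_centered_gaussian_process_def)
  have *: "(\<lambda>\<omega>. \<integral>t. U \<omega> t \<partial>\<nu>) \<in> borel_measurable N"
    if fin: "finite_measure \<nu>" and \<nu>: "sets \<nu> = sets (restrict_space borel {0..T})" for \<nu>
  proof -
    interpret \<nu>: finite_measure \<nu> by fact
    show ?thesis
      using measurable_process_on_product[OF U T \<nu>] by (rule \<nu>.borel_measurable_lebesgue_integral)
  qed
  obtain \<nu>1 \<nu>2 where V_eq: "V = (\<lambda>\<omega>. (\<integral>t. U \<omega> t \<partial>\<nu>1) - (\<integral>t. U \<omega> t \<partial>\<nu>2))"
    and \<nu>: "finite_measure \<nu>1" "sets \<nu>1 = sets (restrict_space borel {0..T})"
      "finite_measure \<nu>2" "sets \<nu>2 = sets (restrict_space borel {0..T})"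
    using V by (auto simp: path_integrals_def)
  show ?thesis
    unfolding V_eq using *[OF \<nu>(1,2)] *[OF \<nu>(3,4)] by (rule borel_measurable_diff)
qed

text \<open>
  Orthogonality passes to the \<open>L\<^sup>2\<close>-closure.  If \<open>V\<close> is an integral of \<open>U\<close> closer than \<open>\<eta>\<close> to \<open>Y\<close>, then
  \<open>E[Y D] = E[(Y - V) D]\<close>, which is in absolute value at most \<open>\<eta> (1 + E[D\<^sup>2])\<close> by
  \<open>\<bar>w d\<bar> \<le> w\<^sup>2 / \<eta> + \<eta> d\<^sup>2\<close>.
\<close>

lemma gaussian_space_orthogonal:
  fixes U :: "'u \<Rightarrow> real \<Rightarrow> real"
  assumes G: "continuous_centered_gaussian_process T N U" and T: "0 \<le> T"
    and D [measurable]: "D \<in> borel_measurable N" and D2: "integrable N (\<lambda>\<omega>. (D \<omega>)\<^sup>2)"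
    and orth: "\<And>t. t \<in> {0..T} \<Longrightarrow> (\<integral>\<omega>. U \<omega> t * D \<omega> \<partial>N) = 0"
    and Y: "Y \<in> gaussian_space T N U"
  shows "(\<integral>\<omega>. Y \<omega> * D \<omega> \<partial>N) = 0"
proof -
  have Y_meas [measurable]: "Y \<in> borel_measurable N" and Y2: "integrable N (\<lambda>\<omega>. (Y \<omega>)\<^sup>2)"
    using Y by (auto simp: gaussian_space_def)
  define d where "d = (\<integral>\<omega>. (D \<omega>)\<^sup>2 \<partial>N)"
  have "d \<ge> 0" unfolding d_def by (rule Bochner_Integration.integral_nonneg) simp
  have bound: "\<bar>\<integral>\<omega>. Y \<omega> * D \<omega> \<partial>N\<bar> \<le> \<eta> * (1 + d)" if \<eta>: "\<eta> > 0" for \<eta>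
  proof -
    obtain V where V: "V \<in> path_integrals T N U"
      "(\<integral>\<^sup>+\<omega>. ennreal ((Y \<omega> - V \<omega>)\<^sup>2) \<partial>N) < ennreal (\<eta>\<^sup>2)"
      using Y \<eta> unfolding gaussian_space_def by (auto dest!: spec[of _ "\<eta>\<^sup>2"])
    note [measurable] = measurable_path_integral[OF G T V(1)]
    have W2: "integrable N (\<lambda>\<omega>. (Y \<omega> - V \<omega>)\<^sup>2)"
      using V(2) by (intro integrableI_nonneg) (auto intro: less_trans)
    have W2_le: "(\<integral>\<omega>. (Y \<omega> - V \<omega>)\<^sup>2 \<partial>N) \<le> \<eta>\<^sup>2"
      using V(2) by (subst (asm) nn_integral_eq_integral[OF W2]) (auto simp: ennreal_less_iff)
    have WD: "integrable N (\<lambda>\<omega>. (Y \<omega> - V \<omega>) * D \<omega>)"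
      using W2 D2 by (intro integrable_mult_of_squares) auto
    have "(\<integral>\<omega>. Y \<omega> * D \<omega> \<partial>N) = (\<integral>\<omega>. (Y \<omega> - V \<omega>) * D \<omega> + V \<omega> * D \<omega> \<partial>N)"
      by (simp add: algebra_simps)
    also have "\<dots> = (\<integral>\<omega>. (Y \<omega> - V \<omega>) * D \<omega> \<partial>N)"
      using path_integral_orthogonal[OF G T D D2 orth V(1)] WD by simp
    finally have "\<bar>\<integral>\<omega>. Y \<omega> * D \<omega> \<partial>N\<bar> = \<bar>\<integral>\<omega>. (Y \<omega> - V \<omega>) * D \<omega> \<partial>N\<bar>" by simp
    also have "\<dots> \<le> (\<integral>\<omega>. \<bar>(Y \<omega> - V \<omega>) * D \<omega>\<bar> \<partial>N)"
      by (rule integral_abs_bound)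
    also have "\<dots> \<le> (\<integral>\<omega>. (Y \<omega> - V \<omega>)\<^sup>2 / \<eta> + \<eta> * (D \<omega>)\<^sup>2 \<partial>N)"
    proof (rule integral_mono)
      fix \<omega>
      let ?w = "\<bar>Y \<omega> - V \<omega>\<bar>" and ?d = "\<bar>D \<omega>\<bar>"
      have "2 * (?w / sqrt \<eta>) * (sqrt \<eta> * ?d) \<le> (?w / sqrt \<eta>)\<^sup>2 + (sqrt \<eta> * ?d)\<^sup>2"
        by (rule sum_squares_bound)
      moreover have "2 * (?w / sqrt \<eta>) * (sqrt \<eta> * ?d) = 2 * (?w * ?d)" "(?w / sqrt \<eta>)\<^sup>2 = ?w\<^sup>2 / \<eta>"
          "(sqrt \<eta> * ?d)\<^sup>2 = \<eta> * ?d\<^sup>2"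
        using \<eta> by (simp_all add: power_divide power_mult_distrib)
      ultimately have "2 * (?w * ?d) \<le> ?w\<^sup>2 / \<eta> + \<eta> * ?d\<^sup>2" by linarith
      moreover have "0 \<le> ?w * ?d" by simp
      ultimately show "\<bar>(Y \<omega> - V \<omega>) * D \<omega>\<bar> \<le> (Y \<omega> - V \<omega>)\<^sup>2 / \<eta> + \<eta> * (D \<omega>)\<^sup>2"
        unfolding abs_mult power2_abs by linarith
    qed (use WD W2 D2 in auto)
    also have "\<dots> = (\<integral>\<omega>. (Y \<omega> - V \<omega>)\<^sup>2 \<partial>N) / \<eta> + \<eta> * d"
      using W2 D2 by (simp add: d_def)
    also have "\<dots> \<le> \<eta>\<^sup>2 / \<eta> + \<eta> * d"
      using W2_le \<eta> by (intro add_right_mono divide_right_mono) auto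
    also have "\<dots> = \<eta> * (1 + d)"
      using \<eta> by (simp add: power2_eq_square algebra_simps)
    finally show ?thesis .
  qed
  have "\<bar>\<integral>\<omega>. Y \<omega> * D \<omega> \<partial>N\<bar> \<le> 0"
  proof (rule field_le_epsilon)
    fix e :: real assume "e > 0"
    then show "\<bar>\<integral>\<omega>. Y \<omega> * D \<omega> \<partial>N\<bar> \<le> 0 + e"
      using bound[of "e / (1 + d)"] \<open>d \<ge> 0\<close> by simp
  qed
  then show ?thesis by simp
qed

text \<open>
  The difference \<open>D = Y - Y'\<close> is orthogonal to every \<open>U(t)\<close>, hence to \<open>Y\<close> and \<open>Y'\<close>, hence to itself.
\<close>

lemma rkhs_map_inj_AE:
  fixes U :: "'u \<Rightarrow> real \<Rightarrow> real"
  assumes G: "continuous_centered_gaussian_process T N U" and T: "0 \<le> T"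
    and Y: "Y \<in> gaussian_space T N U" "Y' \<in> gaussian_space T N U"
    and eq: "rkhs_map T N U Y = rkhs_map T N U Y'"
  shows "AE \<omega> in N. Y \<omega> = Y' \<omega>"
proof -
  have U: "U \<in> N \<rightarrow>\<^sub>M borel_of (path_top T)"
    using G by (auto simp: continuous_centered_gaussian_process_def)
  have [measurable]: "Y \<in> borel_measurable N" "Y' \<in> borel_measurable N"
    and Y2: "integrable N (\<lambda>\<omega>. (Y \<omega>)\<^sup>2)" "integrable N (\<lambda>\<omega>. (Y' \<omega>)\<^sup>2)"
    using Y by (auto simp: gaussian_space_def)
  define D where "D \<omega> = Y \<omega> - Y' \<omega>" for \<omega>
  have D [measurable]: "D \<in> borel_measurable N" unfolding D_def by measurable
  have "integrable N (\<lambda>\<omega>. Y \<omega> * Y' \<omega>)"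
    using Y2 by (intro integrable_mult_of_squares) auto
  then have "integrable N (\<lambda>\<omega>. (Y \<omega>)\<^sup>2 + (Y' \<omega>)\<^sup>2 - 2 * (Y \<omega> * Y' \<omega>))"
    using Y2 by simp
  then have D2: "integrable N (\<lambda>\<omega>. (D \<omega>)\<^sup>2)"
    by (simp add: D_def power2_diff mult.assoc)
  have orth: "(\<integral>\<omega>. U \<omega> t * D \<omega> \<partial>N) = 0" if t: "t \<in> {0..T}" for t
  proof -
    have "integrable N (\<lambda>\<omega>. U \<omega> t * Y \<omega>)" "integrable N (\<lambda>\<omega>. U \<omega> t * Y' \<omega>)"
      using Y2 gaussian_process_square_integrable[OF G t] measurable_process_at[OF U t]
      by (auto intro!: integrable_mult_of_squares)
    moreover have "(\<integral>\<omega>. U \<omega> t * Y \<omega> \<partial>N) = (\<integral>\<omega>. U \<omega> t * Y' \<omega> \<partial>N)"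
      using fun_cong[OF eq, of t] t by (simp add: rkhs_map_def)
    ultimately show ?thesis by (simp add: D_def right_diff_distrib)
  qed
  have YD: "integrable N (\<lambda>\<omega>. Y \<omega> * D \<omega>)" "integrable N (\<lambda>\<omega>. Y' \<omega> * D \<omega>)"
    using Y2 D2 by (auto intro!: integrable_mult_of_squares)
  have "(\<integral>\<omega>. (D \<omega>)\<^sup>2 \<partial>N) = (\<integral>\<omega>. Y \<omega> * D \<omega> - Y' \<omega> * D \<omega> \<partial>N)"
    by (simp add: D_def power2_eq_square algebra_simps)
  also have "\<dots> = 0"
    using YD gaussian_space_orthogonal[OF G T D D2 orth Y(1)] gaussian_space_orthogonal[OF G T D D2 orth Y(2)]
    by simp
  finally have "AE \<omega> in N. (D \<omega>)\<^sup>2 = 0"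
    using integral_nonneg_eq_0_iff_AE[OF D2] by simp
  then show ?thesis by (simp add: D_def)
qed

text \<open>
  The squared norm may be computed from any representative in the Gaussian space, not only from the one that
  \<^const>\<open>inv_into\<close> picks.
\<close>

lemma rkhs_sqnorm_rkhs_map:
  fixes U :: "'u \<Rightarrow> real \<Rightarrow> real"
  assumes G: "continuous_centered_gaussian_process T N U" and T: "0 \<le> T"
    and Y: "Y \<in> gaussian_space T N U"
  shows "rkhs_sqnorm T N U (rkhs_map T N U Y) = ennreal (\<integral>\<omega>. (Y \<omega>)\<^sup>2 \<partial>N)"
proof -
  let ?h = "rkhs_map T N U Y"
  let ?Y = "inv_into (gaussian_space T N U) (rkhs_map T N U) ?h"
  have h: "?h \<in> rkhs_map T N U ` gaussian_space T N U" using Y by simp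
  have Y': "?Y \<in> gaussian_space T N U" using h by (rule inv_into_into)
  have "AE \<omega> in N. ?Y \<omega> = Y \<omega>"
    using f_inv_into_f[OF h] by (intro rkhs_map_inj_AE[OF G T Y' Y])
  then have "(\<integral>\<omega>. (?Y \<omega>)\<^sup>2 \<partial>N) = (\<integral>\<omega>. (Y \<omega>)\<^sup>2 \<partial>N)"
    using Y Y' by (intro integral_cong_AE) (auto simp: gaussian_space_def)
  then show ?thesis using h by (simp add: rkhs_sqnorm_def rkhs_def)
qed

lemma path_integrals_scale:
  fixes U :: "'u \<Rightarrow> real \<Rightarrow> real"
  assumes U: "U \<in> N \<rightarrow>\<^sub>M borel_of (path_top T)" and T: "0 \<le> T"
    and V: "V \<in> path_integrals T N U" and c: "c \<ge> 0"
  obtains V' where "V' \<in> path_integrals T N U" "\<And>\<omega>. \<omega> \<in> space N \<Longrightarrow> V' \<omega> = c * V \<omega>"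
proof -
  have scale: "finite_measure (density \<nu> (\<lambda>_. ennreal c))"
      "\<And>\<omega>. \<omega> \<in> space N \<Longrightarrow> (\<integral>t. U \<omega> t \<partial>density \<nu> (\<lambda>_. ennreal c)) = c * (\<integral>t. U \<omega> t \<partial>\<nu>)"
    if fin: "finite_measure \<nu>" and \<nu>: "sets \<nu> = sets (restrict_space borel {0..T})" for \<nu>
  proof -
    interpret \<nu>: finite_measure \<nu> by fact
    show "finite_measure (density \<nu> (\<lambda>_. ennreal c))"
      by (rule finite_measureI) (simp add: emeasure_density nn_integral_cmult ennreal_mult_eq_top_iff)
    fix \<omega> assume \<omega>: "\<omega> \<in> space N"
    have [measurable]: "(\<lambda>t. U \<omega> t) \<in> borel_measurable \<nu>"
      using measurable_compose[OF measurable_Pair1'[OF \<omega>] measurable_process_on_product[OF U T \<nu>]] by simp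
    show "(\<integral>t. U \<omega> t \<partial>density \<nu> (\<lambda>_. ennreal c)) = c * (\<integral>t. U \<omega> t \<partial>\<nu>)"
      using c by (subst integral_density) auto
  qed
  obtain \<nu>1 \<nu>2 where V_eq: "V = (\<lambda>\<omega>. (\<integral>t. U \<omega> t \<partial>\<nu>1) - (\<integral>t. U \<omega> t \<partial>\<nu>2))"
    and \<nu>: "finite_measure \<nu>1" "sets \<nu>1 = sets (restrict_space borel {0..T})"
      "finite_measure \<nu>2" "sets \<nu>2 = sets (restrict_space borel {0..T})"
    using V by (auto simp: path_integrals_def)
  show ?thesis
  proof (rule that)
    show "(\<lambda>\<omega>. (\<integral>t. U \<omega> t \<partial>density \<nu>1 (\<lambda>_. ennreal c)) - (\<integral>t. U \<omega> t \<partial>density \<nu>2 (\<lambda>_. ennreal c)))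
        \<in> path_integrals T N U"
      unfolding path_integrals_def using \<nu> scale(1)[OF \<nu>(1,2)] scale(1)[OF \<nu>(3,4)]
      by (intro CollectI exI[of _ "density \<nu>1 (\<lambda>_. ennreal c)"] exI[of _ "density \<nu>2 (\<lambda>_. ennreal c)"]) simp
  qed (simp add: V_eq scale(2)[OF \<nu>(1,2)] scale(2)[OF \<nu>(3,4)] right_diff_distrib)
qed

lemma gaussian_space_scale:
  fixes U :: "'u \<Rightarrow> real \<Rightarrow> real"
  assumes G: "continuous_centered_gaussian_process T N U" and T: "0 \<le> T"
    and Y: "Y \<in> gaussian_space T N U" and c: "c > 0"
  shows "(\<lambda>\<omega>. c * Y \<omega>) \<in> gaussian_space T N U"
proof -
  have U: "U \<in> N \<rightarrow>\<^sub>M borel_of (path_top T)"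
    using G by (auto simp: continuous_centered_gaussian_process_def)
  have [measurable]: "Y \<in> borel_measurable N" and Y2: "integrable N (\<lambda>\<omega>. (Y \<omega>)\<^sup>2)"
    using Y by (auto simp: gaussian_space_def)
  have "\<exists>V\<in>path_integrals T N U. (\<integral>\<^sup>+\<omega>. ennreal ((c * Y \<omega> - V \<omega>)\<^sup>2) \<partial>N) < ennreal \<epsilon>" if "\<epsilon> > 0" for \<epsilon>
  proof -
    have "\<epsilon> / c\<^sup>2 > 0" using that c by simp
    then obtain V where V: "V \<in> path_integrals T N U"
      "(\<integral>\<^sup>+\<omega>. ennreal ((Y \<omega> - V \<omega>)\<^sup>2) \<partial>N) < ennreal (\<epsilon> / c\<^sup>2)"
      using Y unfolding gaussian_space_def by blast
    note [measurable] = measurable_path_integral[OF G T V(1)]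
    obtain V' where V': "V' \<in> path_integrals T N U" "\<And>\<omega>. \<omega> \<in> space N \<Longrightarrow> V' \<omega> = c * V \<omega>"
      using path_integrals_scale[OF U T V(1), of c] c by auto
    have "(\<integral>\<^sup>+\<omega>. ennreal ((c * Y \<omega> - V' \<omega>)\<^sup>2) \<partial>N) = (\<integral>\<^sup>+\<omega>. ennreal (c\<^sup>2) * ennreal ((Y \<omega> - V \<omega>)\<^sup>2) \<partial>N)"
      by (intro nn_integral_cong)
         (simp add: V'(2) ennreal_mult'[symmetric] right_diff_distrib[symmetric] power_mult_distrib)
    also have "\<dots> = ennreal (c\<^sup>2) * (\<integral>\<^sup>+\<omega>. ennreal ((Y \<omega> - V \<omega>)\<^sup>2) \<partial>N)"
      by (rule nn_integral_cmult) simp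
    also have "\<dots> < ennreal (c\<^sup>2) * ennreal (\<epsilon> / c\<^sup>2)"
      using V(2) c by (intro ennreal_mult_strict_left_mono) auto
    also have "\<dots> = ennreal \<epsilon>"
      using c that by (simp add: ennreal_mult'[symmetric])
    finally show ?thesis using V'(1) by blast
  qed
  then show ?thesis
    using Y2 by (auto simp: gaussian_space_def power_mult_distrib)
qed

lemma rkhs_map_scale:
  "rkhs_map T N U (\<lambda>\<omega>. c * Y \<omega>) = (\<lambda>t\<in>{0..T}. c * rkhs_map T N U Y t)"
  by (auto simp: rkhs_map_def fun_eq_iff mult.left_commute)

lemma rkhs_sqnorm_scale:
  fixes U :: "'u \<Rightarrow> real \<Rightarrow> real"
  assumes G: "continuous_centered_gaussian_process T N U" and T: "0 \<le> T"
    and c: "c > 0" and h: "h \<in> extensional {0..T}"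
  shows "rkhs_sqnorm T N U (\<lambda>t\<in>{0..T}. c * h t) = ennreal (c\<^sup>2) * rkhs_sqnorm T N U h"
proof (cases "h \<in> rkhs T N U")
  case True
  then obtain Y where Y: "Y \<in> gaussian_space T N U" "h = rkhs_map T N U Y"
    by (auto simp: rkhs_def)
  have "rkhs_sqnorm T N U (\<lambda>t\<in>{0..T}. c * h t) = ennreal (\<integral>\<omega>. (c * Y \<omega>)\<^sup>2 \<partial>N)"
    unfolding Y(2) rkhs_map_scale[symmetric]
    by (rule rkhs_sqnorm_rkhs_map[OF G T gaussian_space_scale[OF G T Y(1) c]])
  also have "\<dots> = ennreal (c\<^sup>2) * rkhs_sqnorm T N U h"
    unfolding Y(2) rkhs_sqnorm_rkhs_map[OF G T Y(1)]
    by (simp add: power_mult_distrib ennreal_mult' )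
  finally show ?thesis .
next
  case False
  have "(\<lambda>t\<in>{0..T}. c * h t) \<notin> rkhs T N U"
  proof
    assume "(\<lambda>t\<in>{0..T}. c * h t) \<in> rkhs T N U"
    then obtain Y where Y: "Y \<in> gaussian_space T N U" "(\<lambda>t\<in>{0..T}. c * h t) = rkhs_map T N U Y"
      by (auto simp: rkhs_def)
    have "rkhs_map T N U (\<lambda>\<omega>. (1 / c) * Y \<omega>) = (\<lambda>t\<in>{0..T}. (1 / c) * (c * h t))"
      unfolding rkhs_map_scale Y(2)[symmetric] by auto
    also have "\<dots> = h"
      using h c by (intro extensionalityI[of _ "{0..T}"]) auto
    finally have h_eq: "rkhs_map T N U (\<lambda>\<omega>. (1 / c) * Y \<omega>) = h" .
    have "(\<lambda>\<omega>. (1 / c) * Y \<omega>) \<in> gaussian_space T N U"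
      using gaussian_space_scale[OF G T Y(1), of "1 / c"] c by simp
    then have "h \<in> rkhs T N U" unfolding rkhs_def h_eq[symmetric] by (rule imageI)
    with False show False by simp
  qed
  with False c show ?thesis
    by (simp add: rkhs_sqnorm_def ennreal_mult_top)
qed

lemma rkhs_sqnorm_zero:
  fixes U :: "'u \<Rightarrow> real \<Rightarrow> real"
  assumes G: "continuous_centered_gaussian_process T N U" and T: "0 \<le> T"
  shows "rkhs_sqnorm T N U (\<lambda>t\<in>{0..T}. 0) = 0"
proof -
  let ?\<nu> = "null_measure (restrict_space borel {0..T} :: real measure)"
  have "finite_measure ?\<nu>" by (rule finite_measureI) simp
  then have "(\<lambda>\<omega>. (\<integral>t. U \<omega> t \<partial>?\<nu>) - (\<integral>t. U \<omega> t \<partial>?\<nu>)) \<in> path_integrals T N U"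
    unfolding path_integrals_def by (intro CollectI exI[of _ ?\<nu>]) simp
  then have "(\<lambda>_. 0) \<in> path_integrals T N U" by simp
  then have "(\<lambda>_. 0) \<in> gaussian_space T N U"
    unfolding gaussian_space_def by (auto intro!: bexI[of _ "\<lambda>_. 0"])
  from rkhs_sqnorm_rkhs_map[OF G T this] show ?thesis
    by (simp add: rkhs_map_def)
qed

lemma rkhs_sqnorm_eq_0D:
  fixes U :: "'u \<Rightarrow> real \<Rightarrow> real"
  assumes G: "continuous_centered_gaussian_process T N U" and T: "0 \<le> T"
    and h: "rkhs_sqnorm T N U h = 0"
  shows "h = (\<lambda>t\<in>{0..T}. 0)"
proof -
  have "h \<in> rkhs T N U" using h by (auto simp: rkhs_sqnorm_def split: if_splits)
  then obtain Y where Y: "Y \<in> gaussian_space T N U" "h = rkhs_map T N U Y"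
    by (auto simp: rkhs_def)
  have Y2: "integrable N (\<lambda>\<omega>. (Y \<omega>)\<^sup>2)" using Y(1) by (simp add: gaussian_space_def)
  have "(\<integral>\<omega>. (Y \<omega>)\<^sup>2 \<partial>N) \<le> 0"
    using h unfolding Y(2) rkhs_sqnorm_rkhs_map[OF G T Y(1)] by (simp add: ennreal_eq_0_iff)
  moreover have "(\<integral>\<omega>. (Y \<omega>)\<^sup>2 \<partial>N) \<ge> 0" by (rule Bochner_Integration.integral_nonneg) simp
  ultimately have "(\<integral>\<omega>. (Y \<omega>)\<^sup>2 \<partial>N) = 0" by simp
  then have "AE \<omega> in N. Y \<omega> = 0"
    using integral_nonneg_eq_0_iff_AE[OF Y2] by simp
  then have "(\<integral>\<omega>. U \<omega> t * Y \<omega> \<partial>N) = 0" for t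
    by (intro integral_eq_zero_AE) auto
  then show ?thesis by (simp add: Y(2) rkhs_map_def)
qed

section \<open>Optimising over the random scale\<close>

lemma psi_pos: "d > 0 \<Longrightarrow> \<theta> > 0 \<Longrightarrow> psi d \<theta> > 0"
  unfolding psi_def by (intro mult_pos_pos add_pos_pos) auto

text \<open>
  The critical point of \<open>a \<mapsto> d a\<^sup>\<theta> + S / a\<^sup>2\<close> solves \<open>a\<^bsup>\<theta>+2\<^esup> = 2 S / (d \<theta>)\<close>, and there the two
  summands have ratio \<open>\<theta> / 2\<close>.  Writing another point as \<open>c = a exp x\<close>, minimality becomes
  \<open>1 + \<theta> / 2 \<le> exp (\<theta> x) + (\<theta> / 2) exp (- 2 x)\<close>, which follows from \<open>1 + y \<le> exp y\<close> since the terms linear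
  in \<open>x\<close> cancel.
\<close>

lemma psi_minimum:
  fixes d \<theta> S :: real
  assumes d: "d > 0" and \<theta>: "\<theta> > 0" and S: "S > 0"
  defines "a \<equiv> (2 * S / (d * \<theta>)) powr (1 / (\<theta> + 2))"
  shows "d * a powr \<theta> + S / a\<^sup>2 = psi d \<theta> * S powr (\<theta> / (\<theta> + 2))"
    and "c > 0 \<Longrightarrow> d * a powr \<theta> + S / a\<^sup>2 \<le> d * c powr \<theta> + S / c\<^sup>2"
proof -
  have a: "a > 0" unfolding a_def using assms by simp
  have sq: "x\<^sup>2 = x powr 2" if "x > 0" for x :: real
    using that by simp
  have crit: "a powr (\<theta> + 2) = 2 * S / (d * \<theta>)"
    unfolding a_def using assms by (simp add: powr_powr)
  have S_a: "S / a\<^sup>2 = (\<theta> / 2) * (d * a powr \<theta>)"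
  proof -
    have "a powr \<theta> * a\<^sup>2 = 2 * S / (d * \<theta>)"
      using crit a by (simp add: powr_add sq del: powr_numeral)
    then show ?thesis using a assms by (simp add: field_simps)
  qed
  show "d * a powr \<theta> + S / a\<^sup>2 = psi d \<theta> * S powr (\<theta> / (\<theta> + 2))"
  proof -
    define w where "w = \<theta> / (\<theta> + 2)"
    have w1: "2 / (\<theta> + 2) = 1 - w" using \<theta> by (simp add: w_def field_simps)
    have at: "a powr \<theta> = 2 powr w * S powr w * (d * \<theta>) powr - w"
    proof -
      have "a powr \<theta> = (2 * S / (d * \<theta>)) powr w"
        unfolding a_def w_def by (simp add: powr_powr)
      also have "\<dots> = (2 * S) powr w / (d * \<theta>) powr w"
        using assms by (intro powr_divide)
      also have "\<dots> = 2 powr w * S powr w * (d * \<theta>) powr - w"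
        using S by (simp add: powr_mult powr_minus divide_inverse)
      finally show ?thesis .
    qed
    have dt: "(d * \<theta>) powr (1 - w) = d * \<theta> * (d * \<theta>) powr - w"
      using assms by (simp add: powr_diff powr_minus divide_inverse)
    have psi: "psi d \<theta> = 2 powr w * (d * (d * \<theta>) powr - w + 1 / 2 * (d * \<theta> * (d * \<theta>) powr - w))"
      unfolding psi_def w1 dt[symmetric] by (simp add: w_def)
    show ?thesis
      unfolding S_a at psi w_def[symmetric] by (simp add: algebra_simps)
  qed
  assume c: "c > 0"
  define x where "x = ln (c / a)"
  have ca: "c = a * exp x" using a c by (simp add: x_def)
  have ct: "c powr \<theta> = a powr \<theta> * exp (\<theta> * x)"
    unfolding ca using a by (simp add: powr_mult exp_powr_real mult.commute)
  have "c\<^sup>2 = a\<^sup>2 * exp (2 * x)"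
    unfolding ca by (simp add: power_mult_distrib exp_double)
  then have Sc: "S / c\<^sup>2 = S / a\<^sup>2 * exp (- 2 * x)"
    by (simp add: exp_minus field_simps)
  have "1 + \<theta> / 2 = (1 + \<theta> * x) + \<theta> / 2 * (1 + (- 2 * x))"
    by (simp add: algebra_simps)
  also have "\<dots> \<le> exp (\<theta> * x) + \<theta> / 2 * exp (- 2 * x)"
    using \<theta> by (intro add_mono mult_left_mono exp_ge_add_one_self) auto
  finally have *: "d * a powr \<theta> * (1 + \<theta> / 2) \<le> d * a powr \<theta> * (exp (\<theta> * x) + \<theta> / 2 * exp (- 2 * x))"
    using d by (intro mult_left_mono) auto
  show "d * a powr \<theta> + S / a\<^sup>2 \<le> d * c powr \<theta> + S / c\<^sup>2"
    unfolding Sc ct S_a using * by (simp add: algebra_simps)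
qed

text \<open>
  The value at \<open>a = 0\<close> enters the minimum only if \<open>S = 0\<close>, when it is the minimum \<open>0\<close>.
\<close>

lemma INF_scaling_cost:
  fixes d \<theta> :: real and S :: ennreal
  assumes d: "d > 0" and \<theta>: "\<theta> > 0"
  shows "(INF a\<in>{0..}. ennreal (d * a powr \<theta>) +
       (if a > 0 then ennreal (1 / a\<^sup>2) * S else if S = 0 then 0 else \<infinity>)) =
     ennreal (psi d \<theta>) * ennreal_powr S (\<theta> / (\<theta> + 2))" (is "(INF a\<in>{0..}. ?f a) = ?rhs")
proof (cases S)
  case top
  have "?f a = \<infinity>" if "a \<ge> 0" for a
    using that top by (auto simp: ennreal_mult_top)
  then have "(INF a\<in>{0..}. ?f a) = \<infinity>"
    by (intro antisym INF_greatest) auto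
  also have "\<infinity> = ?rhs"
    using top psi_pos[OF d \<theta>] by (simp add: ennreal_powr_def ennreal_mult_top)
  finally show ?thesis .
next
  case (real s)
  show ?thesis
  proof (cases "s = 0")
    case True
    have "(INF a\<in>{0..}. ?f a) \<le> ?f 0" by (intro INF_lower) auto
    also have "?f 0 = 0" using True real by simp
    finally show ?thesis using True real by (simp add: ennreal_powr_def)
  next
    case False
    then have s: "s > 0" using real by simp
    define m where "m = (2 * s / (d * \<theta>)) powr (1 / (\<theta> + 2))"
    have m: "m > 0" unfolding m_def using assms s by simp
    have f: "?f a = ennreal (d * a powr \<theta> + s / a\<^sup>2)" if "a > 0" for a
    proof -
      have "ennreal (1 / a\<^sup>2) * S = ennreal (s / a\<^sup>2)"
        using s by (simp add: real ennreal_mult'[symmetric])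
      then show ?thesis
        using that s d by (simp add: ennreal_plus)
    qed
    have rhs: "?rhs = ennreal (d * m powr \<theta> + s / m\<^sup>2)"
      using psi_minimum(1)[OF d \<theta> s] s real psi_pos[OF d \<theta>]
      by (simp add: ennreal_powr_def ennreal_mult''[symmetric] m_def)
    show ?thesis
    proof (rule antisym)
      show "(INF a\<in>{0..}. ?f a) \<le> ?rhs"
        unfolding rhs f[OF m, symmetric] using m by (intro INF_lower) auto
      show "?rhs \<le> (INF a\<in>{0..}. ?f a)"
      proof (rule INF_greatest)
        fix a :: real assume "a \<in> {0..}"
        then consider "a > 0" | "a = 0" by fastforce
        then show "?rhs \<le> ?f a"
        proof cases
          case 1
          then show ?thesis
            unfolding rhs f[OF 1] m_def by (intro ennreal_leI psi_minimum(2) d \<theta> s)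
        qed (use s real in simp)
      qed
    qed
  qed
qed

section \<open>The rate functions of the rescaled process\<close>

lemma coordinate_event_in_sigma_sets:
  assumes Z: "Z \<in> M \<rightarrow>\<^sub>M Pi\<^sub>M UNIV (\<lambda>_. R)" and C: "C \<in> sets R"
  shows "{\<omega> \<in> space M. Z \<omega> n \<in> C} \<in>
    sigma_sets (space M) {Z -` D \<inter> space M | D. D \<in> sets (Pi\<^sub>M UNIV (\<lambda>_. R))}"
proof (rule sigma_sets.Basic)
  let ?D = "(\<lambda>f. f n) -` C \<inter> space (Pi\<^sub>M UNIV (\<lambda>_. R))"
  have "?D \<in> sets (Pi\<^sub>M UNIV (\<lambda>_. R))"
    using C by (intro measurable_sets[OF measurable_component_singleton]) auto
  moreover have "{\<omega> \<in> space M. Z \<omega> n \<in> C} = Z -` ?D \<inter> space M"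
    using measurable_space[OF Z] by auto
  ultimately show "{\<omega> \<in> space M. Z \<omega> n \<in> C} \<in> {Z -` D \<inter> space M | D. D \<in> sets (Pi\<^sub>M UNIV (\<lambda>_. R))}"
    by blast
qed

lemma indep_elements_at:
  assumes M: "prob_space M"
    and indep: "indep_elements M (Pi\<^sub>M UNIV (\<lambda>_. S)) Y (Pi\<^sub>M UNIV (\<lambda>_. S')) Y'"
    and D: "D \<in> sets S" "D' \<in> sets S'"
  shows "\<P>(\<omega> in M. Y \<omega> n \<in> D \<and> Y' \<omega> n \<in> D') = \<P>(\<omega> in M. Y \<omega> n \<in> D) * \<P>(\<omega> in M. Y' \<omega> n \<in> D')"
proof -
  interpret prob_space M by fact
  have Y: "Y \<in> M \<rightarrow>\<^sub>M Pi\<^sub>M UNIV (\<lambda>_. S)" and Y': "Y' \<in> M \<rightarrow>\<^sub>M Pi\<^sub>M UNIV (\<lambda>_. S')"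
    and ind: "indep_set (sigma_sets (space M) {Y -` D \<inter> space M | D. D \<in> sets (Pi\<^sub>M UNIV (\<lambda>_. S))})
       (sigma_sets (space M) {Y' -` D \<inter> space M | D. D \<in> sets (Pi\<^sub>M UNIV (\<lambda>_. S'))})"
    using indep by (auto simp: indep_elements_def)
  have "{\<omega> \<in> space M. Y \<omega> n \<in> D \<and> Y' \<omega> n \<in> D'} = {\<omega> \<in> space M. Y \<omega> n \<in> D} \<inter> {\<omega> \<in> space M. Y' \<omega> n \<in> D'}"
    by auto
  then show ?thesis
    using indep_setD[OF ind coordinate_event_in_sigma_sets[OF Y D(1)] coordinate_event_in_sigma_sets[OF Y' D(2)]] by simp
qed

lemma path_diff_coords_zero_iff:
  assumes "z \<in> path_space T" "b \<in> path_space T"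
  shows "(\<forall>i. path_diff T (path_coord T i z) (path_coord T i b) = (\<lambda>t\<in>{0..T}. 0)) \<longleftrightarrow> z = b"
proof
  assume *: "\<forall>i. path_diff T (path_coord T i z) (path_coord T i b) = (\<lambda>t\<in>{0..T}. 0)"
  have "z t = b t" if t: "t \<in> {0..T}" for t
  proof -
    have "z t $ i = b t $ i" for i
      using fun_cong[OF spec[OF *, of i], of t] t by (simp add: path_diff_def path_coord_def)
    then show ?thesis by (simp add: vec_eq_iff)
  qed
  with assms show "z = b" by (auto simp: path_space_iff intro: extensionalityI)
qed (auto simp: path_diff_def)

lemma rate_ABZ_pos:
  assumes "a > 0"
  shows "rate_ABZ T N U d \<theta> I_B ((a, b), z) = I_B b + ennreal (d * a powr \<theta>) +
     (\<Sum>i\<in>UNIV. ennreal (1 / (2 * a\<^sup>2)) *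
        rkhs_sqnorm T (N i) (U i) (path_diff T (path_coord T i z) (path_coord T i b)))"
  using assms by (simp add: rate_ABZ_def rate_J_def)

lemma rate_ABZ_zero:
  fixes z b :: "real \<Rightarrow> real ^ 'p::finite"
  assumes "z \<in> path_space T" "b \<in> path_space T"
  shows "rate_ABZ T N U d \<theta> I_B ((0, b), z) = (if z = b then I_B b else \<infinity>)"
proof (cases "z = b")
  case True
  then have "path_diff T (path_coord T i z) (path_coord T i b) = (\<lambda>t\<in>{0..T}. 0)" for i
    using path_diff_coords_zero_iff[OF assms] by blast
  then show ?thesis using True by (simp add: rate_ABZ_def rate_J_def)
next
  case False
  then obtain i where i: "path_diff T (path_coord T i z) (path_coord T i b) \<noteq> (\<lambda>t\<in>{0..T}. 0)"
    using path_diff_coords_zero_iff[OF assms] by blast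
  then have J: "rate_J T (N i) (U i) (path_coord T i z) (0, path_coord T i b) = \<infinity>"
    by (simp add: rate_J_def)
  have "(\<Sum>i\<in>UNIV. rate_J T (N i) (U i) (path_coord T i z) (0, path_coord T i b)) = \<infinity>"
    using J by (subst sum.remove[of _ i]) auto
  then show ?thesis using False by (simp add: rate_ABZ_def)
qed

text \<open>
  The right-hand side is the rate that the contraction principle yields for
  \<open>((a, b), x) \<mapsto> ((a, b), a x + b)\<close>.  If \<open>a > 0\<close>, it has a single \<open>x\<close>, and homogeneity of the squared norms
  produces the factor \<open>1 / (2 a\<^sup>2)\<close>; if \<open>a = 0\<close>, every \<open>x\<close> gives the same point.
\<close>

lemma rate_ABZ_eq_INF:
  fixes z b :: "real \<Rightarrow> real ^ 'p::finite"
  assumes T: "0 \<le> T" and G: "\<And>i. continuous_centered_gaussian_process T (N i) (U i)"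
    and a: "a \<ge> 0" and b: "b \<in> path_space T" and z: "z \<in> path_space T"
  shows "rate_ABZ T N U d \<theta> I_B ((a, b), z) =
    (INF x\<in>{x \<in> path_space T. path_affine T a x b = z}. ennreal (d * a powr \<theta>) + I_B b +
       (\<Sum>i\<in>UNIV. ennreal (1 / 2) * rkhs_sqnorm T (N i) (U i) (path_coord T i x)))"
    (is "_ = (INF x\<in>?S. ?I x)")
proof (cases "a > 0")
  case True
  \<comment> \<open>The only preimage of \<open>z\<close>.\<close>
  define x0 where "x0 = (\<lambda>t\<in>{0..T}. (1 / a) *\<^sub>R (z t - b t))"
  have x0: "x0 \<in> path_space T"
    unfolding x0_def using z b by (intro restrict_in_path_space continuous_intros) (auto simp: path_space_iff)
  have "?S = {x0}"
  proof (intro equalityI subsetI)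
    fix x assume x: "x \<in> ?S"
    have "x t = x0 t" if "t \<in> {0..T}" for t
    proof -
      have "z t = a *\<^sub>R x t + b t" using x that by (auto simp: path_affine_def)
      then show ?thesis using that True by (simp add: x0_def)
    qed
    then have "x = x0" using x x0 by (auto simp: path_space_iff intro: extensionalityI)
    then show "x \<in> {x0}" by simp
  next
    fix x assume "x \<in> {x0}"
    moreover have "path_affine T a x0 b = z"
      using z True
      by (intro extensionalityI[of _ "{0..T}"]) (auto simp: path_affine_def x0_def path_space_iff)
    ultimately show "x \<in> ?S" using x0 by simp
  qed
  then have "(INF x\<in>?S. ?I x) = ?I x0" by simp
  also have "\<dots> = rate_ABZ T N U d \<theta> I_B ((a, b), z)"
  proof -
    have "ennreal (1 / 2) * rkhs_sqnorm T (N i) (U i) (path_coord T i x0) =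
        ennreal (1 / (2 * a\<^sup>2)) * rkhs_sqnorm T (N i) (U i) (path_diff T (path_coord T i z) (path_coord T i b))"
      (is "_ = _ * rkhs_sqnorm _ _ _ ?h") for i
    proof -
      have "path_coord T i x0 = (\<lambda>t\<in>{0..T}. (1 / a) * ?h t)"
        by (auto simp: path_coord_def path_diff_def x0_def fun_eq_iff)
      then have "rkhs_sqnorm T (N i) (U i) (path_coord T i x0) =
          ennreal ((1 / a)\<^sup>2) * rkhs_sqnorm T (N i) (U i) ?h"
        using rkhs_sqnorm_scale[OF G T, of "1 / a" ?h i] True by (simp add: path_diff_def)
      moreover have "ennreal (1 / 2) * ennreal ((1 / a)\<^sup>2) = ennreal (1 / (2 * a\<^sup>2))"
        by (subst ennreal_mult'[symmetric]) (auto simp: power_divide)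
      ultimately show ?thesis by (simp add: mult.assoc[symmetric])
    qed
    then show ?thesis unfolding rate_ABZ_pos[OF True] by (simp add: add.commute)
  qed
  finally show ?thesis by simp
next
  case False
  with a have [simp]: "a = 0" by simp
  have aff: "path_affine T 0 x b = b" for x
    using b by (intro extensionalityI[of _ "{0..T}"]) (auto simp: path_affine_def path_space_iff)
  show ?thesis
  proof (cases "z = b")
    case True
    \<comment> \<open>Every path is a preimage of \<open>z = b\<close>, and the zero path is the cheapest.\<close>
    define x0 :: "real \<Rightarrow> real ^ 'p" where "x0 = (\<lambda>t\<in>{0..T}. 0)"
    have x0: "x0 \<in> ?S" unfolding x0_def using aff True by (auto intro!: restrict_in_path_space)
    have "path_coord T i x0 = (\<lambda>t\<in>{0..T}. 0)" for i
      by (auto simp: path_coord_def x0_def fun_eq_iff)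
    then have "?I x0 = I_B b" by (simp add: rkhs_sqnorm_zero[OF G T])
    moreover have "I_B b \<le> ?I x" for x by simp
    ultimately have "(INF x\<in>?S. ?I x) = I_B b"
      using x0 by (intro antisym INF_lower2[of x0] INF_greatest) auto
    then show ?thesis using True rate_ABZ_zero[OF z b] by simp
  next
    case False
    then have S_empty: "?S = {}" using aff by auto
    show ?thesis
      unfolding S_empty using False rate_ABZ_zero[OF z b, of N U d \<theta> I_B] by simp
  qed
qed

lemma ennreal_const_add_INF:
  fixes f :: "'i \<Rightarrow> ennreal"
  assumes "S \<noteq> {}"
  shows "(INF i\<in>S. c + f i) = c + (INF i\<in>S. f i)"
proof (cases "c = \<infinity>")
  case True
  then show ?thesis using assms by simp
next
  case False
  have "(INF i\<in>S. c + f i) - c \<le> f i" if "i \<in> S" for i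
    using INF_lower[OF that, of "\<lambda>i. c + f i"] False by (simp add: ennreal_minus_le_iff)
  then have "(INF i\<in>S. c + f i) - c \<le> (INF i\<in>S. f i)" by (rule INF_greatest)
  then have "(INF i\<in>S. c + f i) \<le> c + (INF i\<in>S. f i)"
    using False by (simp add: ennreal_minus_le_iff)
  moreover have "c + (INF i\<in>S. f i) \<le> (INF i\<in>S. c + f i)"
    by (intro INF_greatest add_left_mono INF_lower)
  ultimately show ?thesis by (rule antisym)
qed

text \<open>
  The infimum over \<open>(a, b)\<close> is taken first over \<open>a\<close>, which leaves \<open>I_B b\<close> aside.  At \<open>a = 0\<close> the cost is finite
  only for \<open>z = b\<close>, that is, when the squared norms of \<open>z - b\<close> vanish.
\<close>

lemma rate_Z_eq_psi:
  fixes z :: "real \<Rightarrow> real ^ 'p::finite" and I_B :: "(real \<Rightarrow> real ^ 'p) \<Rightarrow> ennreal"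
  assumes T: "0 \<le> T" and G: "\<And>i. continuous_centered_gaussian_process T (N i) (U i)"
    and d: "d > 0" and \<theta>: "\<theta> > 0" and z: "z \<in> path_space T"
  shows "rate_Z T N U d \<theta> I_B z =
    (INF b\<in>path_space T. I_B b + ennreal (psi d \<theta>) *
       ennreal_powr (ennreal (1 / 2) *
         (\<Sum>i\<in>UNIV. rkhs_sqnorm T (N i) (U i) (path_diff T (path_coord T i z) (path_coord T i b))))
         (\<theta> / (\<theta> + 2)))" (is "_ = (INF b\<in>_. I_B b + _ * ennreal_powr (?S b) _)")
proof -
  let ?q = "\<lambda>b i. rkhs_sqnorm T (N i) (U i) (path_diff T (path_coord T i z) (path_coord T i b))"
  let ?f = "\<lambda>b a. ennreal (d * a powr \<theta>) +
       (if a > 0 then ennreal (1 / a\<^sup>2) * ?S b else if ?S b = 0 then 0 else \<infinity>)"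
  have rate: "rate_ABZ T N U d \<theta> I_B ((a, b), z) = I_B b + ?f b a"
    if "a \<ge> 0" and b: "b \<in> path_space T" for a b
  proof (cases "a > 0")
    case True
    have "ennreal (1 / a\<^sup>2) * ennreal (1 / 2) = ennreal (1 / (2 * a\<^sup>2))"
      by (subst ennreal_mult'[symmetric]) (auto simp: mult.commute)
    then have "ennreal (1 / a\<^sup>2) * ?S b = (\<Sum>i\<in>UNIV. ennreal (1 / (2 * a\<^sup>2)) * ?q b i)"
      by (simp add: sum_distrib_left mult.assoc[symmetric])
    then show ?thesis using True by (simp add: rate_ABZ_pos add.assoc)
  next
    case False
    with \<open>a \<ge> 0\<close> have [simp]: "a = 0" by simp
    have "?q b i = 0 \<longleftrightarrow> path_diff T (path_coord T i z) (path_coord T i b) = (\<lambda>t\<in>{0..T}. 0)" for i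
      using rkhs_sqnorm_eq_0D[OF G T] rkhs_sqnorm_zero[OF G T] by metis
    then have "?S b = 0 \<longleftrightarrow> z = b"
      using path_diff_coords_zero_iff[OF z b] by simp
    then show ?thesis by (simp add: rate_ABZ_zero[OF z b])
  qed
  have "rate_Z T N U d \<theta> I_B z = (INF b\<in>path_space T. INF a\<in>{0..}. I_B b + ?f b a)"
  proof -
    have "rate_Z T N U d \<theta> I_B z = (INF ab\<in>{0..} \<times> path_space T. I_B (snd ab) + ?f (snd ab) (fst ab))"
      unfolding rate_Z_def by (intro INF_cong refl) (auto simp: rate)
    also have "\<dots> = (INF b\<in>path_space T. INF a\<in>{0..}. I_B b + ?f b a)"
    proof (intro antisym INF_greatest)
      fix b :: "real \<Rightarrow> real ^ 'p" and a assume "b \<in> path_space T" "a \<in> {0::real..}"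
      then show "(INF ab\<in>{0..} \<times> path_space T. I_B (snd ab) + ?f (snd ab) (fst ab)) \<le> I_B b + ?f b a"
        by (intro INF_lower2[of "(a, b)"]) auto
    next
      fix ab assume "ab \<in> {0::real..} \<times> (path_space T :: (real \<Rightarrow> real ^ 'p) set)"
      then show "(INF b\<in>path_space T. INF a\<in>{0..}. I_B b + ?f b a) \<le> I_B (snd ab) + ?f (snd ab) (fst ab)"
        by (intro INF_lower2[of "snd ab"] INF_lower2[of "fst ab"]) auto
    qed
    finally show ?thesis .
  qed
  also have "\<dots> = (INF b\<in>path_space T. I_B b + (INF a\<in>{0..}. ?f b a))"
    by (intro INF_cong refl ennreal_const_add_INF) auto
  also have "\<dots> = (INF b\<in>path_space T. I_B b + ennreal (psi d \<theta>) * ennreal_powr (?S b) (\<theta> / (\<theta> + 2)))"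
    by (intro INF_cong refl arg_cong2[where f="(+)"] INF_scaling_cost d \<theta>)
  finally show ?thesis .
qed

section \<open>Large deviations of the rescaled process\<close>

theorem corollary3p3:
  fixes T :: real
    and M :: "'w measure"
    and \<gamma> :: "nat \<Rightarrow> real"
    and X :: "nat \<Rightarrow> 'w \<Rightarrow> real \<Rightarrow> real ^ 'p::finite"
    and A :: "nat \<Rightarrow> 'w \<Rightarrow> real"
    and B :: "nat \<Rightarrow> 'w \<Rightarrow> real \<Rightarrow> real ^ 'p"
    and k :: "'p \<Rightarrow> real \<Rightarrow> real \<Rightarrow> real"
    and N :: "'p \<Rightarrow> 'u measure"
    and U :: "'p \<Rightarrow> 'u \<Rightarrow> real \<Rightarrow> real"
    and I_B :: "(real \<Rightarrow> real ^ 'p) \<Rightarrow> ennreal"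
    and d \<theta> :: real
  assumes T_pos: "T > 0"
    and M: "prob_space M"
    and speed_pos: "\<And>n. \<gamma> n > 0"
    and speed: "filterlim \<gamma> at_top sequentially"
    and rkhs_process: "\<And>i. continuous_centered_gaussian_process T (N i) (U i)"
    and rkhs_covariance: "\<And>i. has_covariance T (N i) (U i) (k i)"
    and X_gaussian: "\<And>n. continuous_centered_gaussian_process T M (X n)"
    and X_zero: "\<And>n. AE \<omega> in M. X n \<omega> 0 = 0"
    and X_components: "\<And>n. prob_space.indep_vars M (\<lambda>_. borel_of (path_top T))
          (\<lambda>i \<omega>. path_coord T i (X n \<omega>)) UNIV"
    and X_good: "good_rate_function (path_top T)
          (\<lambda>h. \<Sum>i\<in>UNIV. ennreal (1 / 2) * rkhs_sqnorm T (N i) (U i) (path_coord T i h))"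
    and X_LDP: "satisfies_LDP M (path_top T) X \<gamma>
          (\<lambda>h. \<Sum>i\<in>UNIV. ennreal (1 / 2) * rkhs_sqnorm T (N i) (U i) (path_coord T i h))"
    and AB_X_indep: "indep_elements M
          (Pi\<^sub>M UNIV (\<lambda>_. borel_of (prod_topology half_line (path_top T)))) (\<lambda>\<omega> n. (A n \<omega>, B n \<omega>))
          (Pi\<^sub>M UNIV (\<lambda>_. borel_of (path_top T))) (\<lambda>\<omega> n. X n \<omega>)"
    and A_pos: "\<And>n. AE \<omega> in M. A n \<omega> > 0"
    and d_pos: "d > 0" and \<theta>_pos: "\<theta> > 0"
    and A_good: "good_rate_function half_line (\<lambda>x. ennreal (d * x powr \<theta>))"
    and A_LDP: "satisfies_LDP M half_line A \<gamma> (\<lambda>x. ennreal (d * x powr \<theta>))"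
    and B_good: "good_rate_function (path_top T) I_B"
    and B_LDP: "satisfies_LDP M (path_top T) B \<gamma> I_B"
    and A_B_indep: "indep_elements M
          (Pi\<^sub>M UNIV (\<lambda>_. borel_of half_line)) (\<lambda>\<omega> n. A n \<omega>)
          (Pi\<^sub>M UNIV (\<lambda>_. borel_of (path_top T))) (\<lambda>\<omega> n. B n \<omega>)"
  shows "(satisfies_LDP M (prod_topology (prod_topology half_line (path_top T)) (path_top T))
          (\<lambda>n \<omega>. ((A n \<omega>, B n \<omega>), path_affine T (A n \<omega>) (X n \<omega>) (B n \<omega>))) \<gamma> (rate_ABZ T N U d \<theta> I_B)) \<and>
    (\<forall>a\<ge>0. \<forall>b\<in>path_space T. \<forall>z\<in>path_space T.
          rate_ABZ T N U d \<theta> I_B ((a, b), z) =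
            (if a > 0 then I_B b + ennreal (d * a powr \<theta>) +
               (\<Sum>i\<in>UNIV. ennreal (1 / (2 * a\<^sup>2)) *
                  rkhs_sqnorm T (N i) (U i) (path_diff T (path_coord T i z) (path_coord T i b)))
             else if a = 0 \<and>
               (\<forall>i. path_diff T (path_coord T i z) (path_coord T i b) = (\<lambda>t\<in>{0..T}. 0))
             then I_B b
             else \<infinity>)) \<and>
    (good_rate_function (path_top T) (rate_Z T N U d \<theta> I_B)) \<and>
    (satisfies_LDP M (path_top T)
          (\<lambda>n \<omega>. path_affine T (A n \<omega>) (X n \<omega>) (B n \<omega>)) \<gamma> (rate_Z T N U d \<theta> I_B)) \<and>
    (\<forall>z\<in>path_space T. rate_Z T N U d \<theta> I_B z =
          (INF b\<in>path_space T. I_B b + ennreal (psi d \<theta>) *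
             ennreal_powr (ennreal (1 / 2) *
               (\<Sum>i\<in>UNIV. rkhs_sqnorm T (N i) (U i) (path_diff T (path_coord T i z) (path_coord T i b))))
               (\<theta> / (\<theta> + 2))))"
proof -
  interpret prob_space M by fact
  have T: "0 \<le> T" using T_pos by simp
  note G = rkhs_process
  define I_X where "I_X h = (\<Sum>i\<in>UNIV. ennreal (1 / 2) * rkhs_sqnorm T (N i) (U i) (path_coord T i h))" for h
  define I_A where "I_A x = ennreal (d * x powr \<theta>)" for x
  let ?P = "path_top T :: (real \<Rightarrow> real ^ 'p) topology"
  let ?AB = "prod_topology half_line ?P"
  let ?I = "rate_ABZ T N U d \<theta> I_B"
  let ?f = "\<lambda>p. (fst p, (\<lambda>((a, b), x). path_affine T a x b) p)"
  have half_line: "metrizable_space half_line"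
    by (intro metrizable_space_subtopology metrizable_space_euclidean)
  have AB_metrizable: "metrizable_space ?AB"
    by (intro metrizable_space_prod_topology[THEN iffD2, OF disjI2] conjI half_line metrizable_path_top)
  have sc_half_line: "second_countable half_line"
    by (intro second_countable_subtopology second_countable_euclidean)
  have sc_path: "second_countable ?P"
    by (rule second_countable_path_top[OF T])
  have good_AB: "good_rate_function ?AB (\<lambda>(a, b). I_A a + I_B b)"
    using A_good B_good
    by (intro good_rate_function_add metrizable_imp_regular_space half_line metrizable_path_top)
       (simp_all add: I_A_def)
  have LDP_AB: "satisfies_LDP M ?AB (\<lambda>n \<omega>. (A n \<omega>, B n \<omega>)) \<gamma> (\<lambda>(a, b). I_A a + I_B b)"
  proof (rule satisfies_LDP_independent_pair[OF M speed_pos speed _ B_LDP _ B_good])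
    show "satisfies_LDP M half_line A \<gamma> I_A" "good_rate_function half_line I_A"
      using A_LDP A_good by (simp_all add: I_A_def[abs_def])
    show "\<P>(\<omega> in M. A n \<omega> \<in> D1 \<and> B n \<omega> \<in> D2) = \<P>(\<omega> in M. A n \<omega> \<in> D1) * \<P>(\<omega> in M. B n \<omega> \<in> D2)"
      if "D1 \<in> sets (borel_of half_line)" "D2 \<in> sets (borel_of ?P)" for n D1 D2
      using indep_elements_at[OF M A_B_indep that] .
  qed (auto intro: metrizable_imp_regular_space half_line metrizable_path_top sc_half_line sc_path)
  have second_countable_AB: "second_countable ?AB"
    using second_countable_prod_topology[OF sc_half_line sc_path] .
  have X_LDP': "satisfies_LDP M ?P X \<gamma> I_X" and X_good': "good_rate_function ?P I_X"
    using X_LDP X_good by (simp_all add: I_X_def[abs_def])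
  let ?J = "\<lambda>(ab, x). (case ab of (a, b) \<Rightarrow> I_A a + I_B b) + I_X x"
  have LDP_ABX: "satisfies_LDP M (prod_topology ?AB ?P) (\<lambda>n \<omega>. ((A n \<omega>, B n \<omega>), X n \<omega>)) \<gamma> ?J"
  proof (rule satisfies_LDP_independent_pair[OF M speed_pos speed LDP_AB X_LDP' good_AB X_good'])
    show "\<P>(\<omega> in M. (A n \<omega>, B n \<omega>) \<in> D1 \<and> X n \<omega> \<in> D2) =
        \<P>(\<omega> in M. (A n \<omega>, B n \<omega>) \<in> D1) * \<P>(\<omega> in M. X n \<omega> \<in> D2)"
      if "D1 \<in> sets (borel_of ?AB)" "D2 \<in> sets (borel_of ?P)" for n D1 D2
      using indep_elements_at[OF M AB_X_indep that] .
  qed (auto intro: metrizable_imp_regular_space AB_metrizable metrizable_path_top second_countable_AB sc_path)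
  have good_ABX: "good_rate_function (prod_topology ?AB ?P) ?J"
    by (intro good_rate_function_add good_AB X_good' metrizable_imp_regular_space AB_metrizable metrizable_path_top)
  have cont: "continuous_map (prod_topology ?AB ?P) (prod_topology ?AB ?P) ?f"
    by (intro continuous_map_pairedI continuous_map_fst continuous_map_path_affine[OF T])
  have Hausdorff: "Hausdorff_space (prod_topology ?AB ?P)"
    by (intro metrizable_imp_Hausdorff_space metrizable_space_prod_topology[THEN iffD2, OF disjI2]
          conjI AB_metrizable metrizable_path_top)
  have rate: "?I y = (INF p\<in>{p \<in> topspace (prod_topology ?AB ?P). ?f p = y}. ?J p)"
    if y: "y \<in> topspace (prod_topology ?AB ?P)" for y
  proof -
    obtain a b z where y_eq: "y = ((a, b), z)" by (metis prod.exhaust)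
    have abz: "0 \<le> a" "b \<in> path_space T" "z \<in> path_space T"
      using y by (auto simp: y_eq)
    have "{p \<in> topspace (prod_topology ?AB ?P). ?f p = y} =
        (\<lambda>x. ((a, b), x)) ` {x \<in> path_space T. path_affine T a x b = z}"
      using abz by (auto simp: y_eq)
    then show ?thesis
      unfolding y_eq rate_ABZ_eq_INF[OF T G abz] by (simp add: image_image I_A_def I_X_def)
  qed
  note contraction = contraction_principle[OF M speed_pos LDP_ABX good_ABX cont Hausdorff, of ?I]
  have good_ABZ: "good_rate_function (prod_topology ?AB ?P) ?I"
    using rate by (rule contraction(1))
  have LDP_ABZ: "satisfies_LDP M (prod_topology ?AB ?P)
      (\<lambda>n \<omega>. ((A n \<omega>, B n \<omega>), path_affine T (A n \<omega>) (X n \<omega>) (B n \<omega>))) \<gamma> ?I"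
    using contraction(2)[OF rate] by simp
  have rate_Z: "rate_Z T N U d \<theta> I_B z = (INF p\<in>{p \<in> topspace (prod_topology ?AB ?P). snd p = z}. ?I p)"
    if z: "z \<in> topspace ?P" for z
  proof -
    have "{p \<in> topspace (prod_topology ?AB ?P). snd p = z} = (\<lambda>ab. (ab, z)) ` ({0..} \<times> path_space T)"
      using z by auto
    then show ?thesis unfolding rate_Z_def by (simp add: image_image)
  qed
  note contraction_Z = contraction_principle[OF M speed_pos LDP_ABZ good_ABZ
      continuous_map_snd metrizable_imp_Hausdorff_space[OF metrizable_path_top],
      of "rate_Z T N U d \<theta> I_B"]
  have formula: "?I ((a, b), z) =
      (if a > 0 then I_B b + ennreal (d * a powr \<theta>) +
         (\<Sum>i\<in>UNIV. ennreal (1 / (2 * a\<^sup>2)) *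
            rkhs_sqnorm T (N i) (U i) (path_diff T (path_coord T i z) (path_coord T i b)))
       else if a = 0 \<and> (\<forall>i. path_diff T (path_coord T i z) (path_coord T i b) = (\<lambda>t\<in>{0..T}. 0))
       then I_B b
       else \<infinity>)" if "a \<ge> 0" "b \<in> path_space T" "z \<in> path_space T" for a b z
  proof (cases "a > 0")
    case False
    then have "a = 0" using that(1) by simp
    then show ?thesis
      by (simp add: rate_ABZ_zero[OF that(3,2)] path_diff_coords_zero_iff[OF that(3,2)])
  qed (simp add: rate_ABZ_pos)
  show ?thesis
  proof (intro conjI allI impI ballI)
    show "satisfies_LDP M (prod_topology ?AB ?P)
        (\<lambda>n \<omega>. ((A n \<omega>, B n \<omega>), path_affine T (A n \<omega>) (X n \<omega>) (B n \<omega>))) \<gamma> ?I"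
      by (fact LDP_ABZ)
    show "good_rate_function ?P (rate_Z T N U d \<theta> I_B)"
      using rate_Z by (rule contraction_Z(1))
    show "satisfies_LDP M ?P (\<lambda>n \<omega>. path_affine T (A n \<omega>) (X n \<omega>) (B n \<omega>)) \<gamma> (rate_Z T N U d \<theta> I_B)"
      using contraction_Z(2)[OF rate_Z] by simp
  qed (rule formula rate_Z_eq_psi[OF T G d_pos \<theta>_pos]; assumption)+
qed

end
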